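(* Let $G=SU(2)$ with normalized Haar measure $dg$, and define $$\widetilde Z_{SU(2)}^3(s)=\int_{SU(2)}\zeta_{SU(2)}(s,(g,g,g))\,dg=\int_{SU(2)}\sum_{n=1}^\infty\frac{\bigl(\operatorname{tr}(\mathrm{Sym}^{n-1}(g))\bigr)^3}{n^{s+3}}\,dg .$$ Then for $\operatorname{Re}(s)>-2$, $$\widetilde Z_{SU(2)}^3(s)=(1-2^{-s-3})\zeta(s+3),$$ where $\zeta$ is the Riemann zeta function. In particular, $\widetilde Z_{SU(2)}^3(s)$ is meromorphic on $\mathbb{C}$.
   Context: The irreducible unitary representations of $SU(2)$ are the symmetric power representations $\mathrm{Sym}^{n-1}$ ($n\ge1$), of dimension $n$. For a compact group $G$ and $g_1,\dots,g_m\in G$, $\zeta_G(s,(g_1,\dots,g_m))=\sum_{\rho\in\widehat G}\frac{\operatorname{tr}(\rho(g_1))\cdots\operatorname{tr}(\rho(g_m))}{(\deg\rho)^{s+m}}$, where $\widehat G$ is the set of equivalence classes of irreducible unitary representations of $G$. *)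

theory Defs
  imports
    "HOL-Complex_Analysis.Complex_Analysis"
    "HOL-Probability.Probability"
    "HOL-Algebra.Group"
    "Jordan_Normal_Form.Schur_Decomposition"
begin

text \<open>
  Fixed 2x2 matrices (elements of SU(2)) use the finite Cartesian products of HOL-Analysis, which
  carry the topology; representations take values in the matrices of Jordan_Normal_Form, whose
  size is not part of the type. \<open>$\<close> below is the component selection of HOL-Analysis.
\<close>

no_notation Matrix.vec_index (infixl \<open>$\<close> 100)
no_notation fps_nth (infixl \<open>$\<close> 75)

section \<open>Unitary representations and the unitary dual\<close>

definition mat_trace :: "complex mat \<Rightarrow> complex" where
  "mat_trace A = (\<Sum>i<dim_row A. A $$ (i, i))"

definition rep_degree :: "('a, 'b) monoid_scheme \<Rightarrow> ('a \<Rightarrow> complex mat) \<Rightarrow> nat" where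
  "rep_degree G \<pi> = dim_row (\<pi> \<one>\<^bsub>G\<^esub>)"

text \<open>
  Irreducible unitary representations of a compact group are finite-dimensional, so it suffices to
  consider continuous homomorphisms into the unitary groups \<open>U(n)\<close>. The topology on the group is
  the subspace topology of its carrier.
\<close>

definition unitary_rep ::
    "('a::topological_space, 'b) monoid_scheme \<Rightarrow> ('a \<Rightarrow> complex mat) \<Rightarrow> bool" where
  "unitary_rep G \<pi> \<longleftrightarrow> (let n = rep_degree G \<pi> in
     (\<forall>g\<in>carrier G. \<pi> g \<in> carrier_mat n n \<and> \<pi> g * mat_adjoint (\<pi> g) = 1\<^sub>m n) \<and>
     (\<forall>g\<in>carrier G. \<forall>h\<in>carrier G. \<pi> (g \<otimes>\<^bsub>G\<^esub> h) = \<pi> g * \<pi> h) \<and>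
     (\<forall>i<n. \<forall>j<n. continuous_on (carrier G) (\<lambda>g. \<pi> g $$ (i, j))))"

definition irreducible_unitary_rep ::
    "('a::topological_space, 'b) monoid_scheme \<Rightarrow> ('a \<Rightarrow> complex mat) \<Rightarrow> bool" where
  "irreducible_unitary_rep G \<pi> \<longleftrightarrow> (let n = rep_degree G \<pi> in
     unitary_rep G \<pi> \<and> n > 0 \<and>
     (\<forall>W. VectorSpace.subspace class_ring W (module_vec TYPE(complex) n) \<and>
          (\<forall>g\<in>carrier G. \<forall>w\<in>W. \<pi> g *\<^sub>v w \<in> W) \<longrightarrow>
          W = {0\<^sub>v n} \<or> W = carrier_vec n))"

definition rep_equiv ::
    "('a::topological_space, 'b) monoid_scheme \<Rightarrow> (('a \<Rightarrow> complex mat) \<times> ('a \<Rightarrow> complex mat)) set"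
  where
  "rep_equiv G = {(\<pi>, \<sigma>). irreducible_unitary_rep G \<pi> \<and> irreducible_unitary_rep G \<sigma> \<and>
     rep_degree G \<pi> = rep_degree G \<sigma> \<and>
     (\<exists>T \<in> carrier_mat (rep_degree G \<pi>) (rep_degree G \<pi>). invertible_mat T \<and>
        (\<forall>g\<in>carrier G. T * \<pi> g = \<sigma> g * T))}"

definition unitary_dual ::
    "('a::topological_space, 'b) monoid_scheme \<Rightarrow> ('a \<Rightarrow> complex mat) set set" where
  "unitary_dual G = {\<pi>. irreducible_unitary_rep G \<pi>} // rep_equiv G"

section \<open>The zeta function of a compact group\<close>

text \<open>
  Degree and character values do not depend on the representative chosen in a class.
\<close>

definition group_zeta_term ::
    "('a::topological_space, 'b) monoid_scheme \<Rightarrow> complex \<Rightarrow> 'a list \<Rightarrow> ('a \<Rightarrow> complex mat) set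
      \<Rightarrow> complex" where
  "group_zeta_term G s gs c = (let \<rho> = (SOME \<pi>. \<pi> \<in> c) in
     (\<Prod>g\<leftarrow>gs. mat_trace (\<rho> g)) / of_nat (rep_degree G \<rho>) powr (s + of_nat (length gs)))"

definition group_zeta ::
    "('a::topological_space, 'b) monoid_scheme \<Rightarrow> complex \<Rightarrow> 'a list \<Rightarrow> complex" where
  "group_zeta G s gs = (\<Sum>\<^sub>\<infinity>c\<in>unitary_dual G. group_zeta_term G s gs c)"

section \<open>Normalized Haar measure\<close>

text \<open>
  The metric on the ambient type makes regularity of finite Borel measures automatic. For a compact
  group a left-invariant Borel probability measure exists, is unique, and is right-invariant.
\<close>

definition normalized_haar_measure ::
    "('a::metric_space, 'b) monoid_scheme \<Rightarrow> 'a measure \<Rightarrow> bool" where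
  "normalized_haar_measure G \<mu> \<longleftrightarrow>
     prob_space \<mu> \<and> sets \<mu> = sets (restrict_space borel (carrier G)) \<and>
     (\<forall>g\<in>carrier G. \<forall>A\<in>sets \<mu>. emeasure \<mu> ((\<lambda>x. g \<otimes>\<^bsub>G\<^esub> x) ` A) = emeasure \<mu> A)"

section \<open>SU(2) and its symmetric power representations\<close>

definition SU2 :: "(complex^2^2) monoid" where
  "SU2 = \<lparr>carrier = {A. A ** map_matrix cnj (Finite_Cartesian_Product.transpose A)
                          = Finite_Cartesian_Product.mat 1 \<and> Determinants.det A = 1},
          monoid.mult = (**), one = Finite_Cartesian_Product.mat 1\<rparr>"

text \<open>
  The matrix of \<open>Sym\<^sup>k(g)\<close> in the basis \<open>e\<^sub>1\<^sup>k\<^sup>-\<^sup>i e\<^sub>2\<^sup>i\<close> (\<open>0 \<le> i \<le> k\<close>): column \<open>j\<close> holds the coefficients of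
  \<open>(g e\<^sub>1)\<^sup>k\<^sup>-\<^sup>j (g e\<^sub>2)\<^sup>j\<close>, where homogeneous polynomials of degree \<open>k\<close> in \<open>e\<^sub>1, e\<^sub>2\<close> are encoded as
  univariate ones by \<open>e\<^sub>1 = 1\<close>, \<open>e\<^sub>2 = X\<close>. This basis is orthogonal but not orthonormal for the
  invariant inner product, so the matrix itself need not be unitary.
\<close>

definition sym_power :: "nat \<Rightarrow> complex^2^2 \<Rightarrow> complex mat" where
  "sym_power k g = Matrix.mat (k + 1) (k + 1) (\<lambda>(i, j).
     poly.coeff ([:g $ 1 $ 1, g $ 2 $ 1:] ^ (k - j) * [:g $ 1 $ 2, g $ 2 $ 2:] ^ j) i)"

text \<open>
  The measure argument is meant to be the normalized Haar measure on SU(2).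
\<close>

definition Z3_SU2 :: "(complex^2^2) measure \<Rightarrow> complex \<Rightarrow> complex" where
  "Z3_SU2 \<mu> s = (\<integral>g. group_zeta SU2 s [g, g, g] \<partial>\<mu>)"

section \<open>The Riemann zeta function\<close>

text \<open>
  The analytic continuation of the Dirichlet series, with the value 0 at the pole by convention.
\<close>

definition riemann_zeta :: "complex \<Rightarrow> complex" where
  "riemann_zeta = (THE f. f holomorphic_on - {1} \<and> f 1 = 0 \<and>
     (\<forall>s. Re s > 1 \<longrightarrow> f s = (\<Sum>n. 1 / of_nat (Suc n) powr s)))"

end

theory Submission
  imports Defs
begin

text \<open>
  Let \<open>\<chi>\<^sub>k\<close> be the character of \<open>Sym\<^sup>k\<close>. Diagonalising \<open>g\<close> shows that \<open>\<chi>\<^sub>k(g) = U\<^sub>k(tr g)\<close> for the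
  (rescaled) Chebyshev polynomial \<open>U\<^sub>k\<close>. Left invariance under one torus element and one rotation
  forces \<open>\<integral> Sym\<^sup>k = 0\<close> for \<open>k > 0\<close>, so by the Clebsch-Gordan identity for the \<open>U\<^sub>k\<close> the integral of
  \<open>\<chi>\<^sub>k\<^sup>3\<close> is 1 for even \<open>k\<close> and 0 for odd \<open>k\<close>. Summing over \<open>k\<close> leaves the odd part of the zeta series.

  The interchange of sum and integral needs \<open>\<integral> \<bar>\<chi>\<^sub>n\<bar>\<^sup>3 = O(log n)\<close>. This follows from the pointwise bound
  \<open>\<bar>\<chi>\<^sub>n\<bar> \<le> 16 \<Sum>\<^bsub>k \<le> n\<^esub> \<chi>\<^sub>k\<^sup>2 / (k + 1)\<^sup>2\<close> and \<open>\<integral> \<chi>\<^sub>n\<^sup>2 \<chi>\<^sub>k\<^sup>2 = k + 1\<close>, without the Weyl integration formula.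

  That every irreducible \<open>\<pi>\<close> is some \<open>Sym\<^sup>k\<close> is proved without the Peter-Weyl theorem: otherwise, by
  Schur orthogonality, a diagonal coefficient of \<open>\<pi>\<close> is orthogonal to every polynomial in \<open>tr g\<close>, in
  particular to the weights \<open>(2 + tr g) \<chi>\<^sub>n\<^sup>4\<close>. These have total mass \<open>2 (n + 1)\<close>, of which only a
  bounded amount lies away from the identity, where the coefficient is close to 1.

  The continuation of zeta comes from Taylor expansion of \<open>(n + 1)\<^bsup>1 - s\<^esup>\<close> around \<open>n\<close>: summing over \<open>n\<close>
  expresses \<open>(s - 1) \<zeta>(s)\<close> through \<open>\<zeta>(s + 1), \<dots>, \<zeta>(s + m)\<close> and a remainder that is holomorphic further to
  the left.
\<close>

subsection \<open>The group SU(2) and its Haar measure\<close>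

text \<open>A matrix in SU(2) is determined by its first column (a, b), a unit vector of C^2;
  unitarity and the determinant force the second column.\<close>

definition su2 :: "complex \<Rightarrow> complex \<Rightarrow> complex^2^2" where
  "su2 a b = vector [vector [a, - cnj b], vector [b, cnj a]]"

lemma su2_entries [simp]:
  "su2 a b $ 1 $ 1 = a" "su2 a b $ 1 $ 2 = - cnj b" "su2 a b $ 2 $ 1 = b" "su2 a b $ 2 $ 2 = cnj a"
  by (simp_all add: su2_def)

lemma mat2_eq_iff:
  fixes A B :: "'a^2^2"
  shows "A = B \<longleftrightarrow> A $ 1 $ 1 = B $ 1 $ 1 \<and> A $ 1 $ 2 = B $ 1 $ 2 \<and>
    A $ 2 $ 1 = B $ 2 $ 1 \<and> A $ 2 $ 2 = B $ 2 $ 2"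
  by (auto simp: Finite_Cartesian_Product.vec_eq_iff forall_2)

lemma su2_mult: "su2 a b ** su2 c d = su2 (a * c - cnj b * d) (b * c + cnj a * d)"
  by (simp add: mat2_eq_iff matrix_matrix_mult_def sum_2)

lemma mat_1_eq_su2: "Finite_Cartesian_Product.mat 1 = su2 1 0"
  by (simp add: mat2_eq_iff Finite_Cartesian_Product.mat_def)

lemma su2_in_SU2:
  assumes "a * cnj a + b * cnj b = 1"
  shows "su2 a b \<in> carrier SU2"
  using assms
  by (auto simp: SU2_def mat2_eq_iff matrix_matrix_mult_def sum_2
      Finite_Cartesian_Product.transpose_def Finite_Cartesian_Product.mat_def
      Determinants.det_2 algebra_simps)

lemma SU2_cases:
  assumes "g \<in> carrier SU2"
  obtains a b where "g = su2 a b" "a * cnj a + b * cnj b = 1"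
proof -
  let ?a = "g $ 1 $ 1" and ?b = "g $ 2 $ 1" and ?c = "g $ 1 $ 2" and ?d = "g $ 2 $ 2"
  have 1: "?a * cnj ?b + ?c * cnj ?d = 0" "?b * cnj ?b + ?d * cnj ?d = 1" "?a * ?d - ?c * ?b = 1"
    using assms
    by (auto simp: SU2_def mat2_eq_iff matrix_matrix_mult_def sum_2
      Finite_Cartesian_Product.transpose_def Finite_Cartesian_Product.mat_def
      Determinants.det_2 algebra_simps)
  have "cnj ?d = ?a"
  proof -
    \<comment> \<open>Multiplying by the determinant, which is 1, brings in the inner product of the
      two rows; it vanishes, and the squared norm of the second row is left.\<close>
    have "cnj ?d = cnj ?d * (?a * ?d - ?c * ?b)" using 1 by simp
    also have "\<dots> = ?a * (?d * cnj ?d) - ?b * (?c * cnj ?d)" by (simp add: algebra_simps)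
    also have "?c * cnj ?d = - (?a * cnj ?b)" using 1(1) by (simp add: eq_neg_iff_add_eq_0 add.commute)
    also have "?a * (?d * cnj ?d) - ?b * - (?a * cnj ?b) = ?a * (?b * cnj ?b + ?d * cnj ?d)"
      by (simp add: algebra_simps)
    finally show ?thesis using 1 by simp
  qed
  then have d: "?d = cnj ?a" by (metis complex_cnj_cnj)
  have c: "?c = - cnj ?b"
  proof -
    have "?c = ?c * (?b * cnj ?b + ?d * cnj ?d)" using 1 by simp
    also have "\<dots> = cnj ?b * (?c * ?b) + ?d * (?c * cnj ?d)" by (simp add: algebra_simps)
    also have "?c * cnj ?d = - (?a * cnj ?b)" using 1(1) by (simp add: eq_neg_iff_add_eq_0 add.commute)
    also have "cnj ?b * (?c * ?b) + ?d * - (?a * cnj ?b) = - cnj ?b * (?a * ?d - ?c * ?b)"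
      by (simp add: algebra_simps)
    finally show ?thesis using 1 by simp
  qed
  have "g = su2 ?a ?b"
    using c d by (simp add: mat2_eq_iff)
  moreover have "?a * cnj ?a + ?b * cnj ?b = 1"
    using 1(3) c d by (simp add: algebra_simps)
  ultimately show ?thesis using that by blast
qed

lemma SU2_simps [simp]: "monoid.mult SU2 = (**)" "one SU2 = Finite_Cartesian_Product.mat 1"
  by (simp_all add: SU2_def)

lemma one_in_SU2: "Finite_Cartesian_Product.mat 1 \<in> carrier SU2"
  unfolding mat_1_eq_su2 by (rule su2_in_SU2) simp

lemma mult_in_SU2:
  assumes "g \<in> carrier SU2" "h \<in> carrier SU2"
  shows "g ** h \<in> carrier SU2"
proof -
  obtain a b where g: "g = su2 a b" "a * cnj a + b * cnj b = 1" using SU2_cases assms by blast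
  obtain c d where h: "h = su2 c d" "c * cnj c + d * cnj d = 1" using SU2_cases assms by blast
  have "(a * c - cnj b * d) * cnj (a * c - cnj b * d) + (b * c + cnj a * d) * cnj (b * c + cnj a * d)
        = (a * cnj a + b * cnj b) * (c * cnj c + d * cnj d)"
    by (simp add: algebra_simps)
  then show ?thesis
    unfolding g(1) h(1) su2_mult using g h by (intro su2_in_SU2) simp
qed

definition su2_inv :: "complex^2^2 \<Rightarrow> complex^2^2" where
  "su2_inv g = map_matrix cnj (Finite_Cartesian_Product.transpose g)"

lemma su2_inv_su2: "su2_inv (su2 a b) = su2 (cnj a) (- b)"
  by (simp add: su2_inv_def mat2_eq_iff Finite_Cartesian_Product.transpose_def)

lemma su2_inv:
  assumes "g \<in> carrier SU2"
  shows "su2_inv g \<in> carrier SU2" "su2_inv g ** g = Finite_Cartesian_Product.mat 1"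
    "g ** su2_inv g = Finite_Cartesian_Product.mat 1"
proof -
  obtain a b where g: "g = su2 a b" "a * cnj a + b * cnj b = 1" using SU2_cases assms by blast
  show "su2_inv g \<in> carrier SU2"
    unfolding g(1) su2_inv_su2 using g(2) by (intro su2_in_SU2) (simp add: algebra_simps)
  show "su2_inv g ** g = Finite_Cartesian_Product.mat 1" "g ** su2_inv g = Finite_Cartesian_Product.mat 1"
    unfolding g(1) su2_inv_su2 su2_mult mat_1_eq_su2 using g(2) by (simp_all add: algebra_simps)
qed

lemma continuous_on_matrix_mult_left:
  fixes h :: "complex^2^2"
  shows "continuous_on S (\<lambda>g. h ** g)"
  unfolding matrix_matrix_mult_def
  by (intro continuous_on_vec_lambda continuous_intros)

text \<open>Continuous image of the unit sphere of C^2. Compactness bounds continuous functions,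
  which makes them integrable for the Haar measure.\<close>

lemma compact_SU2: "compact (carrier SU2)"
proof -
  have su2_alt: "su2 a b = (\<chi> i j. if i = 1 then (if j = 1 then a else - cnj b)
      else (if j = 1 then b else cnj a))" for a b
    by (simp add: mat2_eq_iff)
  have 1: "a * cnj a + b * cnj b = 1 \<longleftrightarrow> (a, b) \<in> sphere 0 1" for a b
  proof -
    have "a * cnj a + b * cnj b = of_real ((norm (a, b))\<^sup>2)"
      by (simp add: norm_Pair complex_norm_square[symmetric])
    then show ?thesis by (simp only: of_real_eq_1_iff power2_eq_1_iff mem_sphere_0) (use norm_ge_zero[of "(a, b)"] in linarith)
  qed
  have "carrier SU2 = (\<lambda>(a, b). su2 a b) ` sphere 0 1"
    using 1 by (auto intro: su2_in_SU2 elim!: SU2_cases)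
  moreover have "continuous_on (sphere 0 1) (\<lambda>(a, b). su2 a b)"
    unfolding su2_alt case_prod_beta
    by (intro continuous_on_vec_lambda, rename_tac i j, case_tac "i = 1"; case_tac "j = 1")
       (auto intro!: continuous_intros)
  ultimately show ?thesis
    by (simp add: compact_continuous_image)
qed

section \<open>Integration against the invariant probability measure\<close>

locale SU2_haar =
  fixes \<mu> :: "(complex^2^2) measure"
  assumes haar: "normalized_haar_measure SU2 \<mu>"
begin

sublocale prob_space \<mu>
  using haar by (simp add: normalized_haar_measure_def)

lemma sets_haar [measurable_cong]: "sets \<mu> = sets (restrict_space borel (carrier SU2))"
  using haar by (simp add: normalized_haar_measure_def)

lemma space_haar: "space \<mu> = carrier SU2"
  using sets_eq_imp_space_eq[OF sets_haar] by (simp add: space_restrict_space)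

lemma continuous_measurable:
  assumes "continuous_on (carrier SU2) f"
  shows "f \<in> borel_measurable \<mu>"
  using borel_measurable_continuous_on_restrict[OF assms] measurable_cong_sets[OF sets_haar refl]
  by blast

lemma integrable_continuous:
  fixes f :: "complex^2^2 \<Rightarrow> 'b::{banach, second_countable_topology}"
  assumes "continuous_on (carrier SU2) f"
  shows "integrable \<mu> f"
proof -
  have "bounded (f ` carrier SU2)"
    by (intro compact_imp_bounded compact_continuous_image assms compact_SU2)
  then obtain B where "\<And>g. g \<in> carrier SU2 \<Longrightarrow> norm (f g) \<le> B"
    by (auto simp: bounded_iff)
  then show ?thesis
    using assms by (intro integrable_const_bound[of _ B]) (auto simp: space_haar continuous_measurable)
qed

lemma left_mult_measurable:
  assumes "h \<in> carrier SU2"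
  shows "(\<lambda>g. h ** g) \<in> measurable \<mu> \<mu>"
proof -
  have "(\<lambda>g. h ** g) \<in> measurable \<mu> (restrict_space borel (carrier SU2))"
    using assms continuous_measurable[OF continuous_on_matrix_mult_left]
    by (intro measurable_restrict_space2) (auto simp: space_haar mult_in_SU2)
  then show ?thesis
    using measurable_cong_sets[OF refl sets_haar] by blast
qed

text \<open>Invariance is assumed for images of sets, whereas \<open>distr\<close> involves
  preimages; the preimage under \<open>h\<close> is the image under
  \<open>su2_inv h\<close>.\<close>

lemma distr_left_mult:
  assumes h: "h \<in> carrier SU2"
  shows "distr \<mu> \<mu> (\<lambda>g. h ** g) = \<mu>"
proof (rule measure_eqI)
  fix A assume "A \<in> sets (distr \<mu> \<mu> (\<lambda>g. h ** g))"
  then have A: "A \<in> sets \<mu>" by simp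
  have AC: "A \<subseteq> carrier SU2" using sets.sets_into_space[OF A] by (simp add: space_haar)
  have "(\<lambda>g. h ** g) -` A \<inter> space \<mu> = (\<lambda>g. su2_inv h ** g) ` A"
  proof (intro equalityI subsetI)
    fix g assume g: "g \<in> (\<lambda>g. h ** g) -` A \<inter> space \<mu>"
    then have "g = su2_inv h ** (h ** g)"
      by (simp add: matrix_mul_assoc su2_inv[OF h])
    with g show "g \<in> (\<lambda>g. su2_inv h ** g) ` A" by blast
  next
    fix g assume "g \<in> (\<lambda>g. su2_inv h ** g) ` A"
    then obtain a where a: "a \<in> A" "g = su2_inv h ** a" by blast
    then have "h ** g = a" by (simp add: matrix_mul_assoc su2_inv[OF h])
    then show "g \<in> (\<lambda>g. h ** g) -` A \<inter> space \<mu>"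
      using a AC su2_inv[OF h] by (auto simp: space_haar mult_in_SU2)
  qed
  then have "emeasure (distr \<mu> \<mu> (\<lambda>g. h ** g)) A = emeasure \<mu> ((\<lambda>g. su2_inv h ** g) ` A)"
    using A left_mult_measurable[OF h] by (simp add: emeasure_distr)
  also have "\<dots> = emeasure \<mu> A"
    using haar su2_inv(1)[OF h] A by (auto simp: normalized_haar_measure_def)
  finally show "emeasure (distr \<mu> \<mu> (\<lambda>g. h ** g)) A = emeasure \<mu> A" .
qed simp

lemma integral_left_mult:
  fixes f :: "complex^2^2 \<Rightarrow> 'b::{banach, second_countable_topology}"
  assumes h: "h \<in> carrier SU2" and f: "f \<in> borel_measurable \<mu>"
  shows "(\<integral>g. f (h ** g) \<partial>\<mu>) = (\<integral>g. f g \<partial>\<mu>)"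
  using integral_distr[OF left_mult_measurable[OF h] f] distr_left_mult[OF h] by simp

end

subsection \<open>Symmetric powers\<close>

text \<open>The degree-\<open>k\<close> homogenisation of \<open>p\<close>, evaluated at \<open>(u, v)\<close>.\<close>

definition hom_eval :: "nat \<Rightarrow> 'a::comm_ring_1 poly \<Rightarrow> 'a poly \<Rightarrow> 'a poly \<Rightarrow> 'a poly" where
  "hom_eval k p u v = (\<Sum>l\<le>k. Polynomial.smult (coeff p l) (u ^ (k - l) * v ^ l))"

text \<open>Homogenisation turns products into products, here for one linear factor. The degree
  bound makes the coefficient of \<open>p\<close> at \<open>Suc k\<close> vanish, which
  \<open>hom_eval k\<close> does not see.\<close>

lemma hom_eval_linear_mult:
  assumes "degree p \<le> k"
  shows "hom_eval (Suc k) ([:a, c:] * p) u v = (Polynomial.smult a u + Polynomial.smult c v) * hom_eval k p u v"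
proof -
  have "hom_eval (Suc k) ([:a, c:] * p) u v =
      (\<Sum>l\<le>Suc k. Polynomial.smult (a * coeff p l) (u ^ (Suc k - l) * v ^ l)) +
      (\<Sum>l\<le>Suc k. Polynomial.smult (c * coeff (pCons 0 p) l) (u ^ (Suc k - l) * v ^ l))"
    unfolding hom_eval_def sum.distrib[symmetric]
    by (intro sum.cong refl) (auto simp: smult_add_left coeff_pCons split: nat.splits)
  also have "(\<Sum>l\<le>Suc k. Polynomial.smult (a * coeff p l) (u ^ (Suc k - l) * v ^ l)) =
      Polynomial.smult a u * hom_eval k p u v"
    using assms
    by (auto simp: hom_eval_def coeff_eq_0 sum_distrib_left Suc_diff_le algebra_simps intro!: sum.cong)
  also have "(\<Sum>l\<le>Suc k. Polynomial.smult (c * coeff (pCons 0 p) l) (u ^ (Suc k - l) * v ^ l)) =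
      Polynomial.smult c v * hom_eval k p u v"
    by (subst sum.atMost_Suc_shift) (simp add: hom_eval_def sum_distrib_left algebra_simps)
  finally show ?thesis by (simp add: algebra_simps)
qed

lemma degree_linear_powers:
  "degree ([:a, c:] ^ m * [:b, d:] ^ j) \<le> m + j"
proof -
  have *: "degree ([:x, y:] ^ n) \<le> n" for x y :: 'a and n
    using degree_power_le[of "[:x, y:]" n] by (simp split: if_splits)
  show ?thesis
    using degree_mult_le[of "[:a, c:] ^ m" "[:b, d:] ^ j"] *[of a c m] *[of b d j] by linarith
qed

lemma hom_eval_linear_powers:
  "hom_eval (m + j) ([:a, c:] ^ m * [:b, d:] ^ j) u v =
     (Polynomial.smult a u + Polynomial.smult c v) ^ m * (Polynomial.smult b u + Polynomial.smult d v) ^ j"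
proof (induction m)
  case 0
  show ?case
  proof (induction j)
    case 0
    show ?case by (simp add: hom_eval_def)
  next
    case (Suc j)
    then show ?case
      using hom_eval_linear_mult[of "[:b, d:] ^ j" j b d u v] degree_linear_powers[of a c 0 b d j]
      by simp
  qed
next
  case (Suc m)
  then show ?case
    using hom_eval_linear_mult[OF degree_linear_powers[of a c m b d j], of a c u v]
    by (simp only: power_Suc add_Suc mult.assoc)
qed

section \<open>Matrix coefficients of the symmetric powers\<close>

definition sym_coeff :: "nat \<Rightarrow> complex^2^2 \<Rightarrow> nat \<Rightarrow> nat \<Rightarrow> complex" where
  "sym_coeff k g i j = coeff ([:g $ 1 $ 1, g $ 2 $ 1:] ^ (k - j) * [:g $ 1 $ 2, g $ 2 $ 2:] ^ j) i"

lemma sym_power_eq: "sym_power k g = Matrix.mat (k + 1) (k + 1) (\<lambda>(i, j). sym_coeff k g i j)"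
  by (simp add: sym_power_def sym_coeff_def)

text \<open>The columns of \<open>g ** h\<close> are combinations of the columns of \<open>g\<close>
  with coefficients from \<open>h\<close>. Column j for \<open>g ** h\<close> is therefore the form
  given by column j for \<open>h\<close>, evaluated at the columns of \<open>g\<close>.\<close>

lemma sym_coeff_mult:
  assumes "j \<le> k"
  shows "sym_coeff k (g ** h) i j = (\<Sum>l\<le>k. sym_coeff k g i l * sym_coeff k h l j)"
proof -
  let ?u = "[:g $ 1 $ 1, g $ 2 $ 1:]" and ?v = "[:g $ 1 $ 2, g $ 2 $ 2:]"
  have "[:(g ** h) $ 1 $ 1, (g ** h) $ 2 $ 1:] = Polynomial.smult (h $ 1 $ 1) ?u + Polynomial.smult (h $ 2 $ 1) ?v"
    "[:(g ** h) $ 1 $ 2, (g ** h) $ 2 $ 2:] = Polynomial.smult (h $ 1 $ 2) ?u + Polynomial.smult (h $ 2 $ 2) ?v"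
    by (simp_all add: matrix_matrix_mult_def sum_2 algebra_simps)
  then have "sym_coeff k (g ** h) i j =
      coeff (hom_eval ((k - j) + j) ([:h $ 1 $ 1, h $ 2 $ 1:] ^ (k - j) * [:h $ 1 $ 2, h $ 2 $ 2:] ^ j) ?u ?v) i"
    unfolding hom_eval_linear_powers sym_coeff_def by simp
  also have "\<dots> = (\<Sum>l\<le>k. sym_coeff k h l j * sym_coeff k g i l)"
    using assms by (simp add: hom_eval_def coeff_sum sym_coeff_def)
  finally show ?thesis by (simp add: mult.commute)
qed

lemma coeff_linear_power_binomial:
  "coeff ([:a, b:] ^ n) i = of_nat (n choose i) * b ^ i * a ^ (n - i)" for a b :: "'a::comm_ring_1"
proof (cases "i \<le> n")
  case True
  then show ?thesis by (rule coeff_linear_poly_power)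
next
  case False
  moreover have "degree ([:a, b:] ^ n) \<le> n"
    using degree_power_le[of "[:a, b:]" n] by (simp split: if_splits)
  ultimately show ?thesis by (simp add: coeff_eq_0 binomial_eq_0)
qed

lemma sym_coeff_explicit:
  "sym_coeff k g i j = (\<Sum>r\<le>i.
     (of_nat ((k - j) choose r) * (g $ 2 $ 1) ^ r * (g $ 1 $ 1) ^ (k - j - r)) *
     (of_nat (j choose (i - r)) * (g $ 2 $ 2) ^ (i - r) * (g $ 1 $ 2) ^ (j - (i - r))))"
  by (simp add: sym_coeff_def coeff_mult coeff_linear_power_binomial)

lemma continuous_on_sym_coeff: "continuous_on S (\<lambda>g. sym_coeff k g i j)"
  unfolding sym_coeff_explicit by (intro continuous_intros)

lemma sym_coeff_diag:
  "sym_coeff k (su2 z 0) i j = (if i = j then z ^ (k - j) * cnj z ^ j else 0)"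
proof -
  have "[:0, cnj z:] ^ j = monom (cnj z ^ j) j"
    by (induction j) (simp_all add: monom_Suc monom_0 smult_monom)
  then show ?thesis
    by (simp add: sym_coeff_def poly_const_pow smult_monom coeff_monom)
qed

text \<open>As polynomials in two variables the two bases differ only by exchanging the variables.
  The coefficient formula for products preserves this symmetry, hence the induction on
  \<open>k\<close>.\<close>

lemma coeff_coeff_power_transpose:
  fixes a b c d :: "'a::comm_ring_1"
  shows "coeff (coeff ([:[:a, c:], [:b, d:]:] ^ k) j) i = coeff (coeff ([:[:a, b:], [:c, d:]:] ^ k) i) j"
proof (induction k arbitrary: i j)
  case 0
  show ?case by (auto simp: coeff_1)
next
  case (Suc k)
  let ?P = "[:[:a, c:], [:b, d:]:]" and ?Q = "[:[:a, b:], [:c, d:]:]"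
  have 1: "coeff (coeff ?P s) r = coeff (coeff ?Q r) s" for r s
    by (auto simp: coeff_pCons split: nat.splits)
  have "coeff (coeff (?P ^ Suc k) j) i =
      (\<Sum>s\<le>j. \<Sum>r\<le>i. coeff (coeff ?P s) r * coeff (coeff (?P ^ k) (j - s)) (i - r))"
    by (simp only: power_Suc coeff_mult coeff_sum)
  also have "\<dots> = (\<Sum>r\<le>i. \<Sum>s\<le>j. coeff (coeff ?Q r) s * coeff (coeff (?Q ^ k) (i - r)) (j - s))"
    by (subst sum.swap) (simp only: 1 Suc.IH)
  also have "\<dots> = coeff (coeff (?Q ^ Suc k) i) j"
    by (simp only: power_Suc coeff_mult coeff_sum)
  finally show ?case .
qed

text \<open>Both sides are the coefficient of \<open>X\<^sup>i Y\<^sup>j\<close> in \<open>(a + c X + b Y + d X Y)\<^sup>k\<close>.\<close>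

lemma sym_coeff_transpose:
  "of_nat (k choose j) * sym_coeff k g i j =
   of_nat (k choose i) * sym_coeff k (Finite_Cartesian_Product.transpose g) j i"
proof -
  have *: "coeff (of_nat n * p) i = of_nat n * coeff p i" for n i and p :: "complex poly"
    by (simp add: of_nat_poly)
  \<comment> \<open>The binomial theorem in the outer variable Y, applied to (a + c X) + (b + d X)
    Y.\<close>
  have "coeff (coeff ([:[:a, c:], [:b, d:]:] ^ k) j) i =
      of_nat (k choose j) * coeff ([:a, c:] ^ (k - j) * [:b, d:] ^ j) i" for a b c d :: complex and i j
    by (simp add: coeff_linear_power_binomial mult.left_commute[of _ "of_nat (k choose j)"]
        mult.commute[of "[:b, d:] ^ j"] mult.assoc[of "of_nat (k choose j)"] *)
  then show ?thesis
    using coeff_coeff_power_transpose[of "g $ 1 $ 1" "g $ 2 $ 1" "g $ 1 $ 2" "g $ 2 $ 2" k j i]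
    by (simp add: sym_coeff_def Finite_Cartesian_Product.transpose_def)
qed

lemma sym_coeff_su2_inv:
  "sym_coeff k (su2_inv g) i j = cnj (sym_coeff k (Finite_Cartesian_Product.transpose g) i j)"
  by (simp add: sym_coeff_explicit su2_inv_def)

text \<open>The vectors \<open>\<surd>(k choose i) e\<^sub>1\<^sup>k\<^sup>-\<^sup>i e\<^sub>2\<^sup>i\<close> are orthonormal for the invariant inner product.\<close>

definition binom_norm :: "nat \<Rightarrow> nat \<Rightarrow> complex" where
  "binom_norm k i = of_real (sqrt (real (k choose i)))"

lemma binom_norm:
  "cnj (binom_norm k i) = binom_norm k i"
  "binom_norm k i * binom_norm k i = of_nat (k choose i)"
  "i \<le> k \<Longrightarrow> binom_norm k i \<noteq> 0"
  by (simp_all add: binom_norm_def flip: of_real_mult)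

text \<open>Entries of the conjugate D^-1 Sym^k(g) D, where D is the diagonal matrix of the
  \<open>binom_norm k i\<close>: the matrix in the orthonormal basis.\<close>

definition unitary_sym_coeff :: "nat \<Rightarrow> complex^2^2 \<Rightarrow> nat \<Rightarrow> nat \<Rightarrow> complex" where
  "unitary_sym_coeff k g i j = sym_coeff k g i j * binom_norm k j / binom_norm k i"

lemma unitary_sym_coeff_mult:
  assumes "j \<le> k"
  shows "unitary_sym_coeff k (g ** h) i j = (\<Sum>l\<le>k. unitary_sym_coeff k g i l * unitary_sym_coeff k h l j)"
  unfolding unitary_sym_coeff_def sym_coeff_mult[OF assms] sum_distrib_right sum_divide_distrib
  by (intro sum.cong) (auto simp: binom_norm)

text \<open>The normalisation absorbs exactly the binomial factors of the transpose symmetry, so the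
  conjugate transpose of \<open>g\<close> acts by the conjugate transpose matrix.\<close>

lemma unitary_sym_coeff_inv:
  assumes "l \<le> k" "m \<le> k"
  shows "unitary_sym_coeff k (su2_inv g) l m = cnj (unitary_sym_coeff k g m l)"
proof -
  have "binom_norm k m * binom_norm k m * sym_coeff k (Finite_Cartesian_Product.transpose g) l m =
        binom_norm k l * binom_norm k l * sym_coeff k g m l"
    using sym_coeff_transpose[of k l g m] by (simp add: binom_norm)
  from arg_cong[OF this, of cnj]
  have "binom_norm k m * binom_norm k m * cnj (sym_coeff k (Finite_Cartesian_Product.transpose g) l m) =
        binom_norm k l * binom_norm k l * cnj (sym_coeff k g m l)"
    by (simp only: complex_cnj_mult binom_norm(1))
  then show ?thesis
    using assms by (simp add: unitary_sym_coeff_def sym_coeff_su2_inv binom_norm(1,3) frac_eq_eq mult_ac)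
qed

lemma unitary_sym_coeff_one:
  "i \<le> k \<Longrightarrow> unitary_sym_coeff k (Finite_Cartesian_Product.mat 1) i j = (if i = j then 1 else 0)"
  by (auto simp: unitary_sym_coeff_def mat_1_eq_su2 sym_coeff_diag binom_norm)

lemma unitary_sym_coeff_unitary:
  assumes "g \<in> carrier SU2" "i \<le> k" "m \<le> k"
  shows "(\<Sum>l\<le>k. unitary_sym_coeff k g i l * cnj (unitary_sym_coeff k g m l)) = (if i = m then 1 else 0)"
proof -
  have "(\<Sum>l\<le>k. unitary_sym_coeff k g i l * cnj (unitary_sym_coeff k g m l)) =
        (\<Sum>l\<le>k. unitary_sym_coeff k g i l * unitary_sym_coeff k (su2_inv g) l m)"
    using assms by (intro sum.cong) (simp_all add: unitary_sym_coeff_inv)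
  also have "\<dots> = unitary_sym_coeff k (Finite_Cartesian_Product.mat 1) i m"
    using assms by (simp add: su2_inv flip: unitary_sym_coeff_mult)
  finally show ?thesis using assms by (simp add: unitary_sym_coeff_one)
qed

lemma norm_unitary_sym_coeff_le_1:
  assumes "g \<in> carrier SU2" "i \<le> k" "j \<le> k"
  shows "norm (unitary_sym_coeff k g i j) \<le> 1"
proof -
  have "(\<Sum>l\<le>k. complex_of_real ((norm (unitary_sym_coeff k g i l))\<^sup>2)) = 1"
    unfolding complex_norm_square using unitary_sym_coeff_unitary[OF assms(1,2,2)] by simp
  then have "(\<Sum>l\<le>k. (norm (unitary_sym_coeff k g i l))\<^sup>2) = 1"
    by (metis of_real_eq_1_iff of_real_sum)
  moreover have "(norm (unitary_sym_coeff k g i j))\<^sup>2 \<le> (\<Sum>l\<le>k. (norm (unitary_sym_coeff k g i l))\<^sup>2)"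
    using assms by (intro member_le_sum) auto
  ultimately show ?thesis by (simp add: power_le_one_iff abs_square_le_1)
qed

subsection \<open>Characters\<close>

text \<open>The Chebyshev polynomial of the second kind at t / 2, which removes the factor 2 from
  the usual recursion.\<close>

fun cheb :: "nat \<Rightarrow> real \<Rightarrow> real" where
  "cheb 0 t = 1"
| "cheb (Suc 0) t = t"
| "cheb (Suc (Suc n)) t = t * cheb (Suc n) t - cheb n t"

lemma cheb_sin: "cheb n (2 * cos x) * sin x = sin (real (Suc n) * x)"
proof (induction n "2 * cos x" rule: cheb.induct)
  case (3 n)
  have "sin (real (Suc (Suc (Suc n))) * x) + sin (real (Suc n) * x)
        = 2 * cos x * sin (real (Suc (Suc n)) * x)"
  proof -
    define y where "y = real (Suc (Suc n)) * x"
    have "real (Suc (Suc (Suc n))) * x = y + x" "real (Suc n) * x = y - x"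
      by (simp_all add: y_def algebra_simps)
    then show ?thesis unfolding y_def[symmetric] by (simp add: sin_add sin_diff)
  qed
  with 3 show ?case by (simp add: algebra_simps)
next
  case 2
  show ?case using sin_double[of x] by (simp add: algebra_simps)
qed simp

text \<open>Equal to the trace on SU(2) only, where the second diagonal entry is conjugate to the first.\<close>

definition su2_trace :: "complex^2^2 \<Rightarrow> real" where
  "su2_trace g = 2 * Re (g $ 1 $ 1)"

text \<open>Here z and its conjugate are the roots of X^2 - 2 Re(z) X + 1, so the sum obeys the
  recursion of \<open>cheb\<close>. It is the trace of Sym^k on the diagonal torus.\<close>

lemma geometric_cheb:
  assumes "z * cnj z = 1"
  shows "(\<Sum>i\<le>k. z ^ (k - i) * cnj z ^ i) = of_real (cheb k (2 * Re z))"
proof -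
  define S where "S = (\<lambda>k. \<Sum>i\<le>k. z ^ (k - i) * cnj z ^ i)"
  have S_Suc: "S (Suc k) = z * S k + cnj z ^ Suc k" for k
    by (simp add: S_def sum_distrib_left Suc_diff_le algebra_simps)
  have t: "of_real (2 * Re z) = z + cnj z" by (simp add: complex_add_cnj)
  have "S k = of_real (cheb k (2 * Re z))"
  proof (induction k "2 * Re z" rule: cheb.induct)
    case (3 n)
    have "S (Suc (Suc n)) = (z + cnj z) * S (Suc n) - (z * cnj z) * S n"
      by (simp add: S_Suc algebra_simps)
    with 3 assms t show ?case by simp
  qed (simp_all add: S_Suc t[simplified], simp_all add: S_def)
  then show ?thesis by (simp add: S_def)
qed

lemma SU2_Re_le_1:
  assumes "a * cnj a + b * cnj b = 1"
  shows "(Re a)\<^sup>2 \<le> 1"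
proof -
  have "(Re a)\<^sup>2 + ((Im a)\<^sup>2 + (Re b)\<^sup>2 + (Im b)\<^sup>2) = 1"
    using assms by (simp add: complex_eq_iff power2_eq_square)
  moreover have "(Im a)\<^sup>2 + (Re b)\<^sup>2 + (Im b)\<^sup>2 \<ge> 0" by simp
  ultimately show ?thesis by linarith
qed

lemma SU2_diagonalize:
  assumes "g \<in> carrier SU2"
  obtains h z where "h \<in> carrier SU2" "z * cnj z = 1" "2 * Re z = su2_trace g"
    "g = h ** su2 z 0 ** su2_inv h"
proof -
  obtain a b where g: "g = su2 a b" "a * cnj a + b * cnj b = 1" using SU2_cases assms by blast
  have "(Re a)\<^sup>2 \<le> 1" using SU2_Re_le_1 g(2) by blast
  \<comment> \<open>The eigenvalue of \<open>g\<close> in the closed upper half-plane: it has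
    modulus 1 and the same real part as a, hence is a root of the characteristic polynomial.\<close>
  define z where "z = Complex (Re a) (sqrt (1 - (Re a)\<^sup>2))"
  have z: "z * cnj z = 1" "z + cnj z = a + cnj a"
    using \<open>(Re a)\<^sup>2 \<le> 1\<close> by (simp_all add: z_def complex_eq_iff power2_eq_square)
  \<comment> \<open>An eigenvector for \<open>z\<close>: (cnj b, a - z) solves both equations, and
    the first basis vector serves when that one vanishes.\<close>
  obtain p q where pq: "(p, q) \<noteq> (0, 0)" "a * p - cnj b * q = z * p" "b * p + cnj a * q = z * q"
  proof (cases "b = 0 \<and> a = z")
    case True
    then show ?thesis using that[of 1 0] by simp
  next
    case False
    have "b * cnj b + cnj a * (a - z) = z * (a - z)"
    proof -
      have "b * cnj b + cnj a * (a - z) - z * (a - z) = (a * cnj a + b * cnj b) - z * (a + cnj a) + z * z"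
        by (simp add: algebra_simps)
      also have "\<dots> = 1 - z * cnj z" using g z by (simp flip: z(2) add: algebra_simps)
      finally show ?thesis using z by simp
    qed
    with False show ?thesis using that[of "cnj b" "a - z"] by (auto simp: algebra_simps)
  qed
  define N where "N = complex_of_real (sqrt ((cmod p)\<^sup>2 + (cmod q)\<^sup>2))"
  have "(cmod p)\<^sup>2 + (cmod q)\<^sup>2 \<noteq> 0" using pq(1) by (auto simp: sum_power2_eq_zero_iff)
  then have N0: "N \<noteq> 0" by (simp add: N_def)
  have N2: "N * N = p * cnj p + q * cnj q"
  proof -
    have "N * N = complex_of_real ((cmod p)\<^sup>2 + (cmod q)\<^sup>2)"
      by (simp only: N_def real_sqrt_mult_self abs_of_nonneg sum_power2_ge_zero flip: of_real_mult)
    then show ?thesis unfolding of_real_add complex_norm_square .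
  qed
  then have "p * cnj p + q * cnj q \<noteq> 0" using N0 by (metis mult_eq_0_iff)
  have Nc: "cnj N = N" by (simp add: N_def)
  define h where "h = su2 (p / N) (q / N)"
  have h: "h \<in> carrier SU2"
    unfolding h_def using N2 Nc \<open>p * cnj p + q * cnj q \<noteq> 0\<close>
    by (intro su2_in_SU2) (simp flip: add_divide_distrib)
  \<comment> \<open>Both sides have the shape \<open>su2 _ _\<close>, so it is enough to compare
    first columns, and this is the eigenvector equation.\<close>
  have "g ** h = h ** su2 z 0"
  proof -
    have "a * (p / N) - cnj b * (q / N) = p / N * z" "b * (p / N) + cnj a * (q / N) = q / N * z"
      using pq(2,3) by (simp_all flip: add_divide_distrib diff_divide_distrib add: mult.commute)
    then show ?thesis by (simp add: h_def g su2_mult)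
  qed
  then have "g ** h ** su2_inv h = h ** su2 z 0 ** su2_inv h" by simp
  then have "g = h ** su2 z 0 ** su2_inv h"
    by (simp add: su2_inv[OF h] flip: matrix_mul_assoc)
  moreover have "2 * Re z = su2_trace g" by (simp add: su2_trace_def g z_def)
  ultimately show ?thesis using that h z(1) by blast
qed

lemma sym_trace_commute:
  "(\<Sum>i\<le>k. sym_coeff k (g ** h) i i) = (\<Sum>i\<le>k. sym_coeff k (h ** g) i i)"
proof -
  have "(\<Sum>i\<le>k. sym_coeff k (g ** h) i i) = (\<Sum>i\<le>k. \<Sum>l\<le>k. sym_coeff k g i l * sym_coeff k h l i)"
    by (intro sum.cong) (simp_all add: sym_coeff_mult)
  also have "\<dots> = (\<Sum>l\<le>k. \<Sum>i\<le>k. sym_coeff k h l i * sym_coeff k g i l)"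
    by (subst sum.swap) (simp add: mult.commute)
  also have "\<dots> = (\<Sum>i\<le>k. sym_coeff k (h ** g) i i)"
    by (intro sum.cong) (simp_all add: sym_coeff_mult)
  finally show ?thesis .
qed

lemma sym_trace_cheb:
  assumes "g \<in> carrier SU2"
  shows "(\<Sum>i\<le>k. sym_coeff k g i i) = of_real (cheb k (su2_trace g))"
proof -
  obtain h z where h: "h \<in> carrier SU2" "z * cnj z = 1" "2 * Re z = su2_trace g"
    "g = h ** su2 z 0 ** su2_inv h"
    using SU2_diagonalize[OF assms] by blast
  have "(\<Sum>i\<le>k. sym_coeff k g i i) = (\<Sum>i\<le>k. sym_coeff k (su2 z 0) i i)"
    unfolding h(4) sym_trace_commute[of k "h ** su2 z 0"] by (simp add: matrix_mul_assoc su2_inv h)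
  also have "\<dots> = of_real (cheb k (su2_trace g))"
    using geometric_cheb[OF h(2), of k] by (simp add: sym_coeff_diag h(3))
  finally show ?thesis .
qed

lemma mat_trace_sym_power:
  assumes "g \<in> carrier SU2"
  shows "mat_trace (sym_power k g) = of_real (cheb k (su2_trace g))"
  using sym_trace_cheb[OF assms, of k]
  by (simp add: mat_trace_def sym_power_eq lessThan_Suc_atMost)

lemma continuous_on_cheb_trace: "continuous_on S (\<lambda>g. cheb k (su2_trace g))"
proof (induction k "0::real" rule: cheb.induct)
qed (auto simp: su2_trace_def intro!: continuous_intros)

lemma abs_cheb_trace_le:
  assumes "g \<in> carrier SU2"
  shows "\<bar>cheb k (su2_trace g)\<bar> \<le> real (k + 1)"
proof -
  have "\<bar>cheb k (su2_trace g)\<bar> = norm (\<Sum>i\<le>k. unitary_sym_coeff k g i i)"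
    using sym_trace_cheb[OF assms, of k] by (simp add: unitary_sym_coeff_def binom_norm)
  also have "\<dots> \<le> (\<Sum>i\<le>k. 1)"
    using assms by (intro sum_norm_le norm_unitary_sym_coeff_le_1) auto
  finally show ?thesis by simp
qed

subsection \<open>Integrals of products of characters\<close>

text \<open>Raises the larger index by one and lowers the smaller one by one, at the cost of a
  single character. Iteration yields the Clebsch-Gordan formula.\<close>

lemma cheb_mult_step: "cheb (n + d + 1) t * cheb (n + 1) t = cheb d t + cheb (n + d + 2) t * cheb n t"
proof (induction n)
  case 0
  show ?case by (simp add: mult.commute)
next
  case (Suc n)
  then show ?case by (simp add: algebra_simps)
qed

lemma cheb_Clebsch_Gordan:
  assumes "n \<le> m"
  shows "cheb m t * cheb n t = (\<Sum>l\<le>n. cheb (m + n - 2 * l) t)"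
  using assms
proof (induction n arbitrary: m)
  case (Suc n)
  then obtain d where m: "m = n + d + 1" by (metis Suc_eq_plus1 add.commute add_Suc_right le_Suc_ex)
  have "cheb m t * cheb (Suc n) t = cheb d t + cheb (Suc m) t * cheb n t"
    using cheb_mult_step[of n d t] by (simp add: m)
  also have "cheb (Suc m) t * cheb n t = (\<Sum>l\<le>n. cheb (m + Suc n - 2 * l) t)"
    using Suc by simp
  finally show ?case by (simp add: m)
qed simp

lemma cheb_power2: "(cheb n t)\<^sup>2 = (\<Sum>l\<le>n. cheb (2 * l) t)"
proof -
  have "(cheb n t)\<^sup>2 = (\<Sum>l\<le>n. cheb (2 * (n - l)) t)"
    using cheb_Clebsch_Gordan[of n n t] by (simp add: power2_eq_square diff_mult_distrib2 flip: mult_2)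
  also have "\<dots> = (\<Sum>l\<le>n. cheb (2 * l) t)"
    by (rule sum.nat_diff_reindex[of "\<lambda>l. cheb (2 * l) t" "Suc n", unfolded lessThan_Suc_atMost diff_Suc_Suc, simplified])
  finally show ?thesis .
qed

context SU2_haar
begin

text \<open>For fixed j the integrals form a vector that every Sym^k(h) fixes. A torus element kills
  each coordinate of nonzero weight; a rotation then kills the one of weight zero.\<close>

lemma integral_sym_coeff_eq_0:
  assumes "k > 0" "i \<le> k" "j \<le> k"
  shows "(\<integral>g. sym_coeff k g i j \<partial>\<mu>) = 0"
proof -
  let ?P = "\<lambda>i. \<integral>g. sym_coeff k g i j \<partial>\<mu>"
  have int: "integrable \<mu> (\<lambda>g. sym_coeff k g i j)" for i
    by (rule integrable_continuous[OF continuous_on_sym_coeff])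
  have P: "?P i = (\<Sum>l\<le>k. sym_coeff k h i l * ?P l)" if "h \<in> carrier SU2" for h i
  proof -
    have "?P i = (\<integral>g. sym_coeff k (h ** g) i j \<partial>\<mu>)"
      using integral_left_mult[OF that borel_measurable_integrable[OF int[of i]]] by simp
    also have "\<dots> = (\<Sum>l\<le>k. sym_coeff k h i l * ?P l)"
      using assms int by (simp add: sym_coeff_mult)
    finally show ?thesis .
  qed
  have off: "?P i = 0" if "i \<le> k" "2 * i \<noteq> k" for i
  proof -
    \<comment> \<open>The weight of coordinate i; at the angle pi / d the torus element acts on this
      coordinate by -1.\<close>
    define d where "d = real k - 2 * real i"
    have "d \<noteq> 0" using that by (simp add: d_def)
    define z where "z = cis (pi / d)"
    have "z ^ (k - i) * cnj z ^ i = cis (real (k - i) * (pi / d) - real i * (pi / d))"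
      by (simp only: z_def cis_cnj Complex.DeMoivre cis_mult mult_minus_right add_uminus_conv_diff)
    also have "real (k - i) * (pi / d) - real i * (pi / d) = pi"
      using \<open>d \<noteq> 0\<close> \<open>i \<le> k\<close> by (simp add: field_simps of_nat_diff) (simp add: d_def algebra_simps)
    finally have z: "z ^ (k - i) * cnj z ^ i = -1" by simp
    have "su2 z 0 \<in> carrier SU2"
      by (intro su2_in_SU2) (simp add: z_def cis_cnj cis_mult)
    from P[OF this, of i] that(1) have "?P i = z ^ (k - i) * cnj z ^ i * ?P i"
      by (simp add: sym_coeff_diag if_distrib[of "\<lambda>x. x * _"] cong: if_cong)
    with z show ?thesis by simp
  qed
  show ?thesis
  proof (cases "2 * i = k")
    case True
    \<comment> \<open>Only the middle coordinate can survive. For \<open>su2 c c\<close> the row 0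
      of the fixed-point equation says that 0 is a nonzero multiple of it; row 0 is not the middle
      one as k is positive.\<close>
    define c where "c = complex_of_real (1 / sqrt 2)"
    have c: "c * c = 1 / 2" "cnj c = c" "c \<noteq> 0"
      by (simp_all add: c_def flip: of_real_mult)
    have "su2 c c \<in> carrier SU2"
      by (intro su2_in_SU2) (simp add: c)
    from P[OF this, of 0] have "0 = (\<Sum>l\<le>k. sym_coeff k (su2 c c) 0 l * ?P l)"
      using off[of 0] assms(1) by simp
    also have "\<dots> = sym_coeff k (su2 c c) 0 i * ?P i"
    proof -
      have "sym_coeff k (su2 c c) 0 l * ?P l = 0" if "l \<in> {..k} - {i}" for l
        using off[of l] that True by auto
      then have "(\<Sum>l\<in>{..k} - {i}. sym_coeff k (su2 c c) 0 l * ?P l) = 0"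
        by (intro sum.neutral ballI)
      then show ?thesis using assms(2) by (simp add: sum.remove[of _ i])
    qed
    finally show ?thesis using c by (simp add: sym_coeff_explicit)
  qed (use off assms in auto)
qed

lemma integrable_trace_fun:
  "continuous_on UNIV f \<Longrightarrow> integrable \<mu> (\<lambda>g. f (su2_trace g) :: real)"
  by (rule integrable_continuous)
     (auto simp: su2_trace_def intro!: continuous_intros continuous_on_compose2[of UNIV f])

lemma continuous_on_cheb [continuous_intros]:
  "continuous_on S f \<Longrightarrow> continuous_on S (\<lambda>x. cheb n (f x))"
  by (induction n "0 :: real" rule: cheb.induct) (auto intro!: continuous_intros)

lemma integral_cheb: "(\<integral>g. cheb k (su2_trace g) \<partial>\<mu>) = (if k = 0 then 1 else 0)"
proof (cases "k = 0")
  case True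
  then show ?thesis by (simp add: prob_space)
next
  case False
  have "complex_of_real (\<integral>g. cheb k (su2_trace g) \<partial>\<mu>) = (\<integral>g. of_real (cheb k (su2_trace g)) \<partial>\<mu>)"
    by simp
  also have "\<dots> = (\<integral>g. (\<Sum>i\<le>k. sym_coeff k g i i) \<partial>\<mu>)"
    by (intro Bochner_Integration.integral_cong) (simp_all add: space_haar sym_trace_cheb)
  also have "\<dots> = 0"
    using False by (simp add: integral_sym_coeff_eq_0 integrable_continuous continuous_on_sym_coeff)
  finally show ?thesis using False by simp
qed

lemma integral_cheb_mult:
  "(\<integral>g. cheb m (su2_trace g) * cheb n (su2_trace g) \<partial>\<mu>) = (if m = n then 1 else 0)"
proof -
  have "(\<integral>g. cheb m (su2_trace g) * cheb n (su2_trace g) \<partial>\<mu>) = (if m = n then 1 else 0)"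
    if "n \<le> m" for m n
  proof -
    have "(\<integral>g. cheb m (su2_trace g) * cheb n (su2_trace g) \<partial>\<mu>) =
        (\<Sum>l\<le>n. if m + n - 2 * l = 0 then 1 else 0)"
      unfolding cheb_Clebsch_Gordan[OF that]
      by (subst Bochner_Integration.integral_sum)
         (auto intro!: integrable_trace_fun continuous_intros simp: integral_cheb)
    also have "\<dots> = (\<Sum>l\<le>n. if l = n then (if m = n then 1 else 0) else 0)"
      using that by (intro sum.cong) auto
    finally show ?thesis by simp
  qed
  from this[of n m] this[of m n] show ?thesis
    by (cases "n \<le> m") (auto simp: mult.commute)
qed

text \<open>The square contains each character of even index up to 2 n once, so pairing with the
  n-th one picks out l = n / 2, which exists for even n only.\<close>

lemma integral_cheb_cubed:
  "(\<integral>g. cheb n (su2_trace g) ^ 3 \<partial>\<mu>) = (if even n then 1 else 0)"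
proof -
  have "(\<integral>g. cheb n (su2_trace g) ^ 3 \<partial>\<mu>) =
      (\<integral>g. (\<Sum>l\<le>n. cheb (2 * l) (su2_trace g) * cheb n (su2_trace g)) \<partial>\<mu>)"
    by (simp add: power3_eq_cube flip: power2_eq_square sum_distrib_right cheb_power2)
  also have "\<dots> = (\<Sum>l\<le>n. if 2 * l = n then 1 else 0)"
    by (subst Bochner_Integration.integral_sum)
       (auto intro!: integrable_trace_fun continuous_intros simp: integral_cheb_mult)
  also have "\<dots> = (\<Sum>l\<le>n. if l = n div 2 then (if even n then 1 else 0) else 0)"
    by (intro sum.cong) auto
  finally show ?thesis by simp
qed

lemma integral_sum_sum:
  fixes f :: "nat \<Rightarrow> nat \<Rightarrow> real \<Rightarrow> real"
  assumes "\<And>i j. continuous_on UNIV (f i j)"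
  shows "(\<integral>g. (\<Sum>i\<in>A. \<Sum>j\<in>B. f i j (su2_trace g)) \<partial>\<mu>) =
    (\<Sum>i\<in>A. \<Sum>j\<in>B. \<integral>g. f i j (su2_trace g) \<partial>\<mu>)"
  using integrable_trace_fun[OF assms] by simp

text \<open>Both squares expand into orthonormal characters of even index, and the expansions have k
  + 1 of them in common.\<close>

lemma integral_cheb_squares:
  assumes "k \<le> n"
  shows "(\<integral>g. (cheb n (su2_trace g))\<^sup>2 * (cheb k (su2_trace g))\<^sup>2 \<partial>\<mu>) = real (k + 1)"
proof -
  have "(\<integral>g. (cheb n (su2_trace g))\<^sup>2 * (cheb k (su2_trace g))\<^sup>2 \<partial>\<mu>) =
      (\<integral>g. (\<Sum>i\<le>n. \<Sum>j\<le>k. cheb (2 * i) (su2_trace g) * cheb (2 * j) (su2_trace g)) \<partial>\<mu>)"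
    by (simp add: cheb_power2 sum_product)
  also have "\<dots> = (\<Sum>i\<le>n. \<Sum>j\<le>k. if i = j then 1 else 0)"
    by (subst integral_sum_sum) (simp_all add: continuous_intros integral_cheb_mult)
  also have "\<dots> = (\<Sum>j\<le>k. 1)"
    using assms by (subst sum.swap) (auto intro!: sum.cong)
  finally show ?thesis by simp
qed

text \<open>The fourth power expands into products of two characters of even index. A further factor
  t changes the parity and integrates to 0, so only the constant 2 contributes.\<close>

lemma integral_cheb_weight:
  "(\<integral>g. (2 + su2_trace g) * cheb n (su2_trace g) ^ 4 \<partial>\<mu>) = 2 * real (n + 1)"
proof -
  have 4: "x ^ 4 = x\<^sup>2 * x\<^sup>2" for x :: real by (simp flip: power_add)
  have odd: "(\<integral>g. cheb (Suc 0) (su2_trace g) * cheb (2 * i) (su2_trace g) * cheb (2 * j) (su2_trace g) \<partial>\<mu>) = 0"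
    for i j
  proof (cases i)
    case 0
    then show ?thesis using integral_cheb_mult[of 1 "2 * j"] by simp
  next
    case (Suc i')
    have "cheb (Suc 0) t * cheb (2 * i) t = cheb (2 * i + 1) t + cheb (2 * i' + 1) t" for t
      by (simp add: Suc)
    moreover have "2 * i + 1 \<noteq> 2 * j" "2 * i' + 1 \<noteq> 2 * j" by presburger+
    ultimately show ?thesis
      by (simp only: distrib_right)
         (subst Bochner_Integration.integral_add,
           auto intro!: integrable_trace_fun continuous_intros simp: integral_cheb_mult simp del: cheb.simps)
  qed
  have "t * cheb n t ^ 4 = (\<Sum>i\<le>n. \<Sum>j\<le>n. cheb (Suc 0) t * cheb (2 * i) t * cheb (2 * j) t)" for t
  proof -
    have "cheb n t ^ 4 = (\<Sum>i\<le>n. \<Sum>j\<le>n. cheb (2 * i) t * cheb (2 * j) t)"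
      unfolding 4 cheb_power2 by (rule sum_product)
    then show ?thesis by (simp add: sum_distrib_left mult.assoc)
  qed
  then have "(\<integral>g. su2_trace g * cheb n (su2_trace g) ^ 4 \<partial>\<mu>) =
      (\<Sum>i\<le>n. \<Sum>j\<le>n. \<integral>g. cheb (Suc 0) (su2_trace g) * cheb (2 * i) (su2_trace g) *
          cheb (2 * j) (su2_trace g) \<partial>\<mu>)"
    by (simp only:) (subst integral_sum_sum, auto intro!: continuous_intros)
  also have "\<dots> = 0" by (simp only: odd sum.neutral_const)
  finally have "(\<integral>g. su2_trace g * cheb n (su2_trace g) ^ 4 \<partial>\<mu>) = 0" by simp
  moreover have "(\<integral>g. cheb n (su2_trace g) ^ 4 \<partial>\<mu>) = real (n + 1)"
    unfolding 4 by (rule integral_cheb_squares) simp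
  ultimately show ?thesis
    by (simp only: distrib_right, subst Bochner_Integration.integral_add)
       (auto intro!: integrable_trace_fun continuous_intros)
qed

end

subsection \<open>The Riemann zeta function\<close>

lemma holomorphic_on_suminf:
  fixes f :: "nat \<Rightarrow> complex \<Rightarrow> complex"
  assumes "open S" and hol: "\<And>n. f n holomorphic_on S"
    and bd: "\<And>x. x \<in> S \<Longrightarrow> \<exists>d>0. \<exists>M. cball x d \<subseteq> S \<and> summable M \<and>
               (\<forall>n. \<forall>y\<in>cball x d. norm (f n y) \<le> M n)"
  shows "(\<lambda>s. \<Sum>n. f n s) holomorphic_on S"
proof (rule holomorphic_uniform_sequence[OF \<open>open S\<close>])
  show "(\<lambda>s. \<Sum>k<n. f k s) holomorphic_on S" for n
    by (intro holomorphic_intros hol)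
next
  fix x assume "x \<in> S"
  then obtain d M where d: "d > 0" "cball x d \<subseteq> S" and "summable M"
    and M: "\<And>n y. y \<in> cball x d \<Longrightarrow> norm (f n y) \<le> M n"
    using bd by meson
  have "uniform_limit (cball x d) (\<lambda>n s. \<Sum>k<n. f k s) (\<lambda>s. \<Sum>n. f n s) sequentially"
    using M \<open>summable M\<close> by (rule Weierstrass_m_test)
  with d show "\<exists>d>0. cball x d \<subseteq> S \<and>
      uniform_limit (cball x d) (\<lambda>n s. \<Sum>k<n. f k s) (\<lambda>s. \<Sum>n. f n s) sequentially"
    by (intro exI[of _ d] conjI)
qed

section \<open>Taylor expansion of the terms of the zeta series\<close>

definition falling_fact :: "complex \<Rightarrow> nat \<Rightarrow> complex" where
  "falling_fact w k = (\<Prod>i<k. w - of_nat i)"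

lemma falling_fact_Suc: "falling_fact w (Suc k) = falling_fact w k * (w - of_nat k)"
  by (simp add: falling_fact_def)

text \<open>Taylor's formula on the segment from n to n + 1. As Re w is at most K + 1, the
  derivative of order K + 1 has its largest modulus at the left endpoint n.\<close>

lemma powr_Taylor_bound:
  fixes w :: complex
  assumes "n \<ge> 1" and w: "Re w \<le> Suc K"
  shows "norm (of_nat (Suc n) powr w - (\<Sum>k\<le>K. falling_fact w k * of_nat n powr (w - of_nat k) / fact k))
           \<le> norm (falling_fact w (Suc K)) * real n powr (Re w - Suc K) / fact K"
proof -
  let ?S = "closed_segment (of_nat n :: complex) (of_nat (Suc n))"
  let ?f = "\<lambda>i x. falling_fact w i * x powr (w - of_nat i)"
  have S: "\<exists>r. x = of_real r \<and> r \<ge> real n" if "x \<in> ?S" for x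
  proof -
    from that obtain u where u: "0 \<le> u" "x = (1 - u) *\<^sub>R of_nat n + u *\<^sub>R of_nat (Suc n)"
      by (auto simp: in_segment)
    then have "x = of_real (real n + u)"
      by (simp add: scaleR_conv_of_real algebra_simps)
    with u show ?thesis by (intro exI[of _ "real n + u"]) auto
  qed
  have "cmod (?f 0 (of_nat (Suc n)) -
          (\<Sum>i\<le>K. ?f i (of_nat n) * (of_nat (Suc n) - of_nat n) ^ i / fact i))
        \<le> (norm (falling_fact w (Suc K)) * real n powr (Re w - Suc K)) *
          cmod (of_nat (Suc n) - of_nat n) ^ (Suc K) / fact K"
  proof (rule complex_Taylor)
    fix i x assume "x \<in> ?S"
    then obtain r where r: "x = of_real r" "r \<ge> real n" using S by blast
    with \<open>n \<ge> 1\<close> have "x \<notin> \<real>\<^sub>\<le>\<^sub>0" by (auto simp: complex_nonpos_Reals_iff)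
    then show "(?f i has_field_derivative ?f (Suc i) x) (at x within ?S)"
      by (auto intro!: derivative_eq_intros simp: falling_fact_Suc algebra_simps)
  next
    fix x assume "x \<in> ?S"
    then obtain r where r: "x = of_real r" "r \<ge> real n" using S by blast
    have "norm (x powr (w - of_nat (Suc K))) = r powr (Re w - Suc K)"
      using r \<open>n \<ge> 1\<close> by (simp add: norm_powr_real_powr)
    also have "\<dots> \<le> real n powr (Re w - Suc K)"
      using r w \<open>n \<ge> 1\<close> by (intro powr_mono2') auto
    finally show "norm (?f (Suc K) x) \<le> norm (falling_fact w (Suc K)) * real n powr (Re w - Suc K)"
      by (simp add: norm_mult mult_left_mono del: of_nat_Suc)
  qed auto
  then show ?thesis by (simp add: falling_fact_def)
qed

abbreviation right_half_plane :: "real \<Rightarrow> complex set" where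
  "right_half_plane x \<equiv> {s. Re s > x}"

lemma ex_Re_gt [simp]: "\<exists>s. Re s > x"
  by (rule exI[of _ "of_real (x + 1)"]) simp

lemma right_half_plane_facts:
  "open (right_half_plane x)" "connected (right_half_plane x)"
  by (auto intro: open_halfspace_Re_gt convex_connected convex_halfspace_Re_gt)

lemma cball_in_right_half_plane:
  assumes "Re x > a"
  obtains d b where "d > 0" "b > a" "\<And>y. y \<in> cball x d \<Longrightarrow> Re y \<ge> b"
proof -
  define d where "d = (Re x - a) / 2"
  have "Re y \<ge> Re x - d" if "y \<in> cball x d" for y
  proof -
    have "\<bar>Re (x - y)\<bar> \<le> cmod (x - y)" by (rule abs_Re_le_cmod)
    with that show ?thesis by (auto simp: dist_norm)
  qed
  moreover have "d > 0" "Re x - d > a" using assms by (auto simp: d_def field_simps)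
  ultimately show ?thesis using that by blast
qed

lemma summable_Suc_powr:
  fixes a :: real
  assumes "a < -1"
  shows "summable (\<lambda>n. real (Suc n) powr a)"
  using assms summable_real_powr_iff[of a] summable_Suc_iff[of "\<lambda>n. real n powr a"] by simp

text \<open>The remainder of order K for the expansion of (n + 2)^(1 - s) around n + 1; the shift
  lets the series start at n = 0.\<close>

definition taylor_rem :: "nat \<Rightarrow> nat \<Rightarrow> complex \<Rightarrow> complex" where
  "taylor_rem K n s = of_nat (Suc (Suc n)) powr (1 - s) -
     (\<Sum>k\<le>K. falling_fact (1 - s) k * of_nat (Suc n) powr (1 - s - of_nat k) / fact k)"

lemma norm_taylor_rem:
  assumes "Re s \<ge> b" "b > 1 - real K"
  shows "norm (taylor_rem K n s) \<le> norm (falling_fact (1 - s) (Suc K)) * real (Suc n) powr (- b - K)"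
proof -
  have "norm (taylor_rem K n s) \<le>
      norm (falling_fact (1 - s) (Suc K)) * real (Suc n) powr (Re (1 - s) - Suc K) / fact K"
    unfolding taylor_rem_def using assms by (intro powr_Taylor_bound) auto
  also have "\<dots> \<le> norm (falling_fact (1 - s) (Suc K)) * real (Suc n) powr (Re (1 - s) - Suc K)"
    using divide_left_mono[of 1 "fact K :: real" "norm (falling_fact (1 - s) (Suc K)) *
      real (Suc n) powr (Re (1 - s) - Suc K)"] by (simp add: fact_ge_1 del: of_nat_Suc)
  also have "\<dots> \<le> norm (falling_fact (1 - s) (Suc K)) * real (Suc n) powr (- b - K)"
    using assms by (intro mult_left_mono powr_mono) auto
  finally show ?thesis .
qed

text \<open>The terms decay like n^(- Re s - K), locally uniformly in s, so the series converges K
  units further to the left than the zeta series.\<close>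

lemma holomorphic_taylor_rem:
  "(\<lambda>s. \<Sum>n. taylor_rem K n s) holomorphic_on right_half_plane (1 - real K)"
proof (rule holomorphic_on_suminf)
  show "taylor_rem K n holomorphic_on right_half_plane (1 - real K)" for n
    unfolding taylor_rem_def falling_fact_def by (intro holomorphic_intros) auto
next
  fix x :: complex assume "x \<in> right_half_plane (1 - real K)"
  then obtain d b where d: "d > 0" "b > 1 - real K" "\<And>y. y \<in> cball x d \<Longrightarrow> Re y \<ge> b"
    using cball_in_right_half_plane by (metis mem_Collect_eq)
  have "compact ((\<lambda>s. falling_fact (1 - s) (Suc K)) ` cball x d)"
    unfolding falling_fact_def by (intro compact_continuous_image continuous_intros) auto
  then obtain C where C: "\<And>y. y \<in> cball x d \<Longrightarrow> norm (falling_fact (1 - y) (Suc K)) \<le> C"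
    by (meson bounded_iff compact_imp_bounded imageI)
  have "norm (taylor_rem K n y) \<le> C * real (Suc n) powr (- b - K)" if "y \<in> cball x d" for n y
    using norm_taylor_rem[OF d(3)[OF that] d(2), of n] C[OF that]
    by (meson mult_right_mono order_trans powr_ge_zero)
  moreover have "summable (\<lambda>n. C * real (Suc n) powr (- b - K))"
    using d by (intro summable_mult summable_Suc_powr) auto
  moreover have "cball x d \<subseteq> right_half_plane (1 - real K)"
    using d by force
  ultimately show "\<exists>d>0. \<exists>M. cball x d \<subseteq> right_half_plane (1 - real K) \<and> summable M \<and>
               (\<forall>n. \<forall>y\<in>cball x d. norm (taylor_rem K n y) \<le> M n)"
    using d(1) by blast
qed (rule right_half_plane_facts)

definition dirichlet_zeta :: "complex \<Rightarrow> complex" where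
  "dirichlet_zeta s = (\<Sum>n. 1 / of_nat (Suc n) powr s)"

lemma norm_zeta_term: "norm (1 / of_nat (Suc n) powr s :: complex) = real (Suc n) powr (- Re s)"
  by (simp add: norm_divide norm_powr_real_powr powr_minus_divide del: of_nat_Suc)

lemma summable_zeta:
  assumes "Re s > 1"
  shows "summable (\<lambda>n. norm (1 / of_nat (Suc n) powr s :: complex))"
  unfolding norm_zeta_term using assms by (intro summable_Suc_powr) auto

lemma dirichlet_zeta_sums:
  assumes "Re s > 1"
  shows "(\<lambda>n. 1 / of_nat (Suc n) powr s) sums dirichlet_zeta s"
  unfolding dirichlet_zeta_def
  by (rule summable_sums) (rule summable_norm_cancel[OF summable_zeta[OF assms]])

lemma holomorphic_dirichlet_zeta: "dirichlet_zeta holomorphic_on right_half_plane 1"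
  unfolding dirichlet_zeta_def [abs_def]
proof (rule holomorphic_on_suminf)
  fix x :: complex assume "x \<in> right_half_plane 1"
  then obtain d b where d: "d > 0" "b > 1" "\<And>y. y \<in> cball x d \<Longrightarrow> Re y \<ge> b"
    using cball_in_right_half_plane by (metis mem_Collect_eq)
  have "norm (1 / of_nat (Suc n) powr y :: complex) \<le> real (Suc n) powr (- b)"
    if "y \<in> cball x d" for n y
    unfolding norm_zeta_term using d(3)[OF that] by (intro powr_mono) auto
  moreover have "summable (\<lambda>n. real (Suc n) powr (- b))"
    using d by (intro summable_Suc_powr) auto
  moreover have "cball x d \<subseteq> right_half_plane 1" using d by force
  ultimately show "\<exists>d>0. \<exists>M. cball x d \<subseteq> right_half_plane 1 \<and> summable M \<and>
               (\<forall>n. \<forall>y\<in>cball x d. norm (1 / of_nat (Suc n) powr y :: complex) \<le> M n)"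
    using d(1) by blast
next
  show "(\<lambda>s. 1 / of_nat (Suc n) powr s) holomorphic_on right_half_plane 1" for n
    by (intro holomorphic_intros) auto
qed (rule right_half_plane_facts)

text \<open>The Taylor formula is summed over n. Moving the term of order 0 to the left makes that
  side telescope to -1; order 1 gives (1 - s) times zeta, and the higher orders give zeta at s + 1,
  ..., s + m.\<close>

lemma zeta_recurrence:
  assumes s: "Re s > 1"
  shows "(s - 1) * dirichlet_zeta s = 1 + (\<Sum>n. taylor_rem (Suc m) n s) +
    (\<Sum>k=2..Suc m. falling_fact (1 - s) k / fact k * dirichlet_zeta (s + of_nat k - 1))"
proof -
  let ?p = "\<lambda>n. of_nat (Suc n) powr (1 - s) :: complex"
  let ?c = "\<lambda>k. falling_fact (1 - s) k / fact k"
  have "(\<lambda>n. norm (?p n)) \<longlonglongrightarrow> 0"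
  proof -
    have "((\<lambda>n. real n powr (1 - Re s)) \<longlongrightarrow> 0) sequentially"
      using s by (intro tendsto_neg_powr filterlim_real_sequentially) auto
    then have "((\<lambda>n. real (Suc n) powr (1 - Re s)) \<longlongrightarrow> 0) sequentially"
      by (rule LIMSEQ_Suc)
    then show ?thesis by (simp add: norm_powr_real_powr del: of_nat_Suc)
  qed
  then have "?p \<longlonglongrightarrow> 0" by (rule tendsto_norm_zero_cancel)
  then have tel: "(\<lambda>n. ?p (Suc n) - ?p n) sums (0 - ?p 0)"
    by (rule telescope_sums)
  have pw: "of_nat (Suc n) powr (1 - s - of_nat k) = 1 / of_nat (Suc n) powr (s + of_nat k - 1)"
    for n k
    using powr_minus_divide[of "of_nat (Suc n)" "s + of_nat k - 1"] by (simp add: algebra_simps)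
  have zs: "(\<lambda>n. ?c k * of_nat (Suc n) powr (1 - s - of_nat k)) sums
             (?c k * dirichlet_zeta (s + of_nat k - 1))" if "k \<ge> 1" for k
    unfolding pw using s that by (intro sums_mult dirichlet_zeta_sums) auto
  have "(\<lambda>n. (?p (Suc n) - ?p n) - (\<Sum>k=1..Suc m. ?c k * of_nat (Suc n) powr (1 - s - of_nat k))) sums
         ((0 - ?p 0) - (\<Sum>k=1..Suc m. ?c k * dirichlet_zeta (s + of_nat k - 1)))"
    by (intro sums_diff sums_sum tel zs) auto
  also have "(\<lambda>n. (?p (Suc n) - ?p n) - (\<Sum>k=1..Suc m. ?c k * of_nat (Suc n) powr (1 - s - of_nat k)))
             = (\<lambda>n. taylor_rem (Suc m) n s)"
  proof
    fix n
    have "{..Suc m} = insert 0 {1..Suc m}" by auto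
    then show "(?p (Suc n) - ?p n) - (\<Sum>k=1..Suc m. ?c k * of_nat (Suc n) powr (1 - s - of_nat k))
               = taylor_rem (Suc m) n s"
      by (simp add: taylor_rem_def falling_fact_def del: of_nat_Suc)
  qed
  finally have "(\<Sum>n. taylor_rem (Suc m) n s) =
      - 1 - (\<Sum>k=1..Suc m. ?c k * dirichlet_zeta (s + of_nat k - 1))"
    by (simp add: sums_iff)
  moreover have "(\<Sum>k=1..Suc m. ?c k * dirichlet_zeta (s + of_nat k - 1)) =
      (1 - s) * dirichlet_zeta s + (\<Sum>k=2..Suc m. ?c k * dirichlet_zeta (s + of_nat k - 1))"
    by (subst sum.atLeast_Suc_atMost) (auto simp: falling_fact_def numeral_2_eq_2)
  ultimately have "(\<Sum>n. taylor_rem (Suc m) n s) =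
      - 1 - ((1 - s) * dirichlet_zeta s + (\<Sum>k=2..Suc m. ?c k * dirichlet_zeta (s + of_nat k - 1)))"
    by (rule trans[OF _ arg_cong])
  then show ?thesis
    by (simp add: algebra_simps del: sum.cl_ivl_Suc)
qed

text \<open>Each step gains one unit to the left, because the shifted zeta values in the recurrence
  only involve the previous half-plane. The factor s - 1 removes the pole.\<close>

lemma zeta_extension_step:
  "\<exists>f. f holomorphic_on right_half_plane (1 - real m) \<and>
       (\<forall>s. Re s > 1 \<longrightarrow> f s = (s - 1) * dirichlet_zeta s)"
proof (induction m)
  case 0
  have "(\<lambda>s. (s - 1) * dirichlet_zeta s) holomorphic_on right_half_plane (1 - real 0)"
    using holomorphic_dirichlet_zeta by (auto intro!: holomorphic_intros)
  then show ?case by blast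
next
  case (Suc m)
  then obtain f where f: "f holomorphic_on right_half_plane (1 - real m)"
    "\<And>s. Re s > 1 \<Longrightarrow> f s = (s - 1) * dirichlet_zeta s" by blast
  \<comment> \<open>The last factor of \<open>falling_fact (1 - s) k\<close> is -(s + k - 2), and it
    turns zeta at s + k - 1 into \<open>f\<close>; hence the index k - 1 and the changed
    sign.\<close>
  define g where "g = (\<lambda>s. 1 + (\<Sum>n. taylor_rem (Suc m) n s) -
    (\<Sum>k=2..Suc m. falling_fact (1 - s) (k - 1) / fact k * f (s + of_nat k - 1)))"
  have shift: "(\<lambda>s. f (s + of_nat k - 1)) holomorphic_on right_half_plane (1 - real (Suc m))"
    if "k \<ge> 2" for k
    using that by (intro holomorphic_on_compose_gen[OF _ f(1), unfolded o_def] holomorphic_intros) auto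
  have "g holomorphic_on right_half_plane (1 - real (Suc m))"
    unfolding g_def falling_fact_def
    by (intro holomorphic_intros holomorphic_taylor_rem shift) auto
  moreover have "g s = (s - 1) * dirichlet_zeta s" if "Re s > 1" for s
  proof -
    have "falling_fact (1 - s) k / fact k * dirichlet_zeta (s + of_nat k - 1) =
          - (falling_fact (1 - s) (k - 1) / fact k * f (s + of_nat k - 1))" if k: "k \<in> {2..Suc m}" for k
    proof -
      obtain j where "k = Suc j" using k by (cases k) auto
      then have "falling_fact (1 - s) k = - (falling_fact (1 - s) (k - 1) * (s + of_nat k - 2))"
        by (simp add: falling_fact_Suc algebra_simps)
      moreover have "f (s + of_nat k - 1) = (s + of_nat k - 2) * dirichlet_zeta (s + of_nat k - 1)"
        using k \<open>Re s > 1\<close> by (simp add: f(2) algebra_simps)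
      ultimately show ?thesis by simp
    qed
    then have "(\<Sum>k=2..Suc m. falling_fact (1 - s) k / fact k * dirichlet_zeta (s + of_nat k - 1)) =
        - (\<Sum>k=2..Suc m. falling_fact (1 - s) (k - 1) / fact k * f (s + of_nat k - 1))"
      unfolding sum_negf[symmetric] by (rule sum.cong[OF refl])
    then show ?thesis
      unfolding zeta_recurrence[OF that, of m] g_def by simp
  qed
  ultimately show ?case by blast
qed

lemma zeta_entire:
  obtains F where "F holomorphic_on UNIV" "\<And>s. Re s > 1 \<Longrightarrow> F s = (s - 1) * dirichlet_zeta s"
proof -
  obtain f where f: "\<And>m. f m holomorphic_on right_half_plane (1 - real m)"
    "\<And>m s. Re s > 1 \<Longrightarrow> f m s = (s - 1) * dirichlet_zeta s"
    using zeta_extension_step by metis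
  have agree: "f m s = f n s" if "m \<le> n" "Re s > 1 - real m" for m n s
  proof (rule analytic_continuation_open[of "right_half_plane 1" "right_half_plane (1 - real m)" "f m" "f n"])
    show "f n holomorphic_on right_half_plane (1 - real m)"
      using f(1)[of n] by (rule holomorphic_on_subset) (use that in auto)
  qed (use that f in \<open>auto simp: right_half_plane_facts\<close>)
  \<comment> \<open>By \<open>agree\<close>, any index whose half-plane contains s gives the same
    value.\<close>
  define F where "F = (\<lambda>s. f (nat \<lceil>2 - Re s\<rceil>) s)"
  have F: "F s = f m s" if "Re s > 1 - real m" for m s
  proof -
    have "Re s > 1 - real (nat \<lceil>2 - Re s\<rceil>)" by linarith
    then show ?thesis unfolding F_def using that agree by (metis nat_le_linear)
  qed
  have "F holomorphic_on (\<Union>m. right_half_plane (1 - real m))"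
  proof (rule holomorphic_on_UN_open)
    show "F holomorphic_on right_half_plane (1 - real m)" for m
      using f(1)[of m] by (rule holomorphic_transform) (simp add: F)
  qed (rule right_half_plane_facts)
  also have "(\<Union>m. right_half_plane (1 - real m)) = UNIV"
  proof -
    have "\<exists>m. Re s > 1 - real m" for s
      using reals_Archimedean2[of "1 - Re s"] by (metis diff_less_eq less_diff_eq add.commute)
    then show ?thesis by blast
  qed
  finally have "F holomorphic_on UNIV" .
  moreover have "F s = (s - 1) * dirichlet_zeta s" if "Re s > 1" for s
    using F[of 0 s] f(2)[of s 0] that by simp
  ultimately show ?thesis using that by blast
qed

text \<open>Resolves the definite description: the entire function divided by s - 1 gives existence,
  and the identity theorem on the connected punctured plane, with the fixed value at 1, gives
  uniqueness.\<close>

lemma riemann_zeta_entire: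
  obtains F where "F holomorphic_on UNIV" "\<And>s. s \<noteq> 1 \<Longrightarrow> riemann_zeta s = F s / (s - 1)"
    "\<And>s. Re s > 1 \<Longrightarrow> riemann_zeta s = dirichlet_zeta s"
proof -
  obtain F where F: "F holomorphic_on UNIV" "\<And>s. Re s > 1 \<Longrightarrow> F s = (s - 1) * dirichlet_zeta s"
    using zeta_entire by blast
  define z where "z = (\<lambda>s. if s = 1 then 0 else F s / (s - 1))"
  have "(\<lambda>s. F s / (s - 1)) holomorphic_on - {1}"
    by (intro holomorphic_intros holomorphic_on_subset[OF F(1)]) auto
  then have hol: "z holomorphic_on - {1}"
    by (rule holomorphic_transform) (auto simp: z_def)
  have z1: "z s = dirichlet_zeta s" if "Re s > 1" for s
  proof -
    have "s \<noteq> 1" using that by auto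
    then show ?thesis using that by (simp add: z_def F)
  qed
  have "riemann_zeta = z"
    unfolding riemann_zeta_def
  proof (rule the_equality)
    show "z holomorphic_on - {1} \<and> z 1 = 0 \<and>
        (\<forall>s. Re s > 1 \<longrightarrow> z s = (\<Sum>n. 1 / of_nat (Suc n) powr s))"
      using hol z1 by (auto simp: z_def dirichlet_zeta_def)
  next
    fix f assume f: "f holomorphic_on - {1} \<and> f 1 = 0 \<and>
        (\<forall>s. Re s > 1 \<longrightarrow> f s = (\<Sum>n. 1 / of_nat (Suc n) powr s))"
    show "f = z"
    proof
      fix s
      show "f s = z s"
      proof (cases "s = 1")
        case True
        then show ?thesis using f by (simp add: z_def)
      next
        case False
        show ?thesis
        proof (rule analytic_continuation_open[of "right_half_plane 1" "- {1}" f z])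
          show "connected (- {1 :: complex})"
            by (rule connected_punctured_universe) simp
        qed (use False f hol z1 in \<open>auto simp: right_half_plane_facts dirichlet_zeta_def\<close>)
      qed
    qed
  qed
  then have "riemann_zeta s = F s / (s - 1)" if "s \<noteq> 1" for s
    unfolding \<open>riemann_zeta = z\<close> z_def using that by simp
  moreover have "riemann_zeta s = dirichlet_zeta s" if "Re s > 1" for s
    using z1[OF that] \<open>riemann_zeta = z\<close> by simp
  ultimately show ?thesis using that F(1) by blast
qed

lemma odd_zeta_sums:
  assumes w: "Re w > 1"
  shows "(\<lambda>n. if even n then 1 / of_nat (Suc n) powr w else 0) sums
           ((1 - 2 powr (- w)) * dirichlet_zeta w)"
proof -
  let ?a = "\<lambda>n. 1 / of_nat (Suc n) powr w :: complex"
  \<comment> \<open>Index n stands for the integer n + 1, so the even integers sit at the odd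
    indices.\<close>
  have "?a (2 * m + 1) = 2 powr (- w) * ?a m" for m
  proof -
    have "(of_nat (Suc (2 * m + 1)) :: complex) = 2 * of_nat (Suc m)" by simp
    then have "(of_nat (Suc (2 * m + 1)) :: complex) powr w = 2 powr w * of_nat (Suc m) powr w"
      by (simp only:) (rule powr_times_real, auto)
    then show ?thesis by (simp add: powr_minus_divide)
  qed
  then have "(\<lambda>m. ?a (2 * m + 1)) sums (2 powr (- w) * dirichlet_zeta w)"
    using sums_mult[OF dirichlet_zeta_sums[OF w]] by simp
  then have "(\<lambda>m. if odd (2 * m + 1) then ?a (2 * m + 1) else 0) sums (2 powr (- w) * dirichlet_zeta w)"
    by simp
  moreover have "strict_mono (\<lambda>m::nat. 2 * m + 1)" by (simp add: strict_mono_def)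
  moreover have "n \<in> range (\<lambda>m. 2 * m + 1)" if "odd n" for n :: nat
    using that by (auto elim: oddE)
  ultimately have "(\<lambda>n. if odd n then ?a n else 0) sums (2 powr (- w) * dirichlet_zeta w)"
    by (subst (asm) sums_mono_reindex) auto
  then have "(\<lambda>n. ?a n - (if odd n then ?a n else 0)) sums
      (dirichlet_zeta w - 2 powr (- w) * dirichlet_zeta w)"
    by (intro sums_diff dirichlet_zeta_sums w)
  also have "(\<lambda>n. ?a n - (if odd n then ?a n else 0)) = (\<lambda>n. if even n then ?a n else 0)"
    by auto
  finally show ?thesis by (simp add: algebra_simps)
qed

subsection \<open>Integrability of the Dirichlet series\<close>

lemma sin_ge_half:
  fixes x :: real
  assumes "0 \<le> x" "x \<le> 1"
  shows "x / 2 \<le> sin x"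
proof -
  have "sin 0 - 0 / 2 \<le> sin x - x / 2"
  proof (rule DERIV_nonneg_imp_nondecreasing[OF assms(1)])
    fix y assume y: "0 \<le> y" "y \<le> x"
    \<comment> \<open>Up to pi / 3, which exceeds 1, the cosine is at least 1/2; so sin y - y / 2 is
      nondecreasing there.\<close>
    have "cos (pi / 3) \<le> cos y"
      using y assms pi_gt3 by (intro cos_monotone_0_pi_le) auto
    then show "\<exists>d. ((\<lambda>y. sin y - y / 2) has_real_derivative d) (at y) \<and> 0 \<le> d"
      by (intro exI[of _ "cos y - 1 / 2"]) (auto intro!: derivative_eq_intros simp: cos_60)
  qed
  then show ?thesis by simp
qed

lemma cheb_2: "cheb n 2 = real (n + 1)"
  by (induction n "2 :: real" rule: cheb.induct) auto

lemma cheb_minus: "cheb n (- t) = (-1) ^ n * cheb n t"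
  by (induction n t rule: cheb.induct) (auto simp: algebra_simps)

lemma abs_cheb_sin:
  "sin x \<ge> 0 \<Longrightarrow> \<bar>cheb n (2 * cos x)\<bar> * sin x = \<bar>sin (real (Suc n) * x)\<bar>"
  by (metis cheb_sin abs_mult abs_of_nonneg)

text \<open>At 2 cos x the character is at most of order min (n + 1) (1 / x), and every index k with
  (k + 1) x at most 1 contributes at least 1/4 to the sum. The cases x = 0 and x > 1 are
  direct.\<close>

lemma cheb_pointwise_bound_aux:
  assumes x: "0 \<le> x" "x \<le> pi / 2"
  shows "\<bar>cheb n (2 * cos x)\<bar> \<le> 16 * (\<Sum>k\<le>n. (cheb k (2 * cos x))\<^sup>2 / (real (k + 1))\<^sup>2)"
proof -
  let ?u = "\<lambda>k. cheb k (2 * cos x)"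
  let ?K = "\<Sum>k\<le>n. (?u k)\<^sup>2 / (real (k + 1))\<^sup>2"
  have K: "(\<Sum>k\<in>A. (?u k)\<^sup>2 / (real (k + 1))\<^sup>2) \<le> ?K" if "A \<subseteq> {..n}" for A
    using that by (intro sum_mono2) auto
  consider "x = 0" | "0 < x" "x \<le> 1" | "1 < x" using x by linarith
  then show ?thesis
  proof cases
    case 1
    have "(\<Sum>k\<le>n. (real (k + 1))\<^sup>2 / (real (k + 1))\<^sup>2) = (\<Sum>k\<le>n. 1)"
      by (intro sum.cong) auto
    then show ?thesis unfolding 1 cos_zero mult_1_right cheb_2 by simp
  next
    case 3
    have "sin 1 \<le> sin x" using 3 x by (intro sin_monotone_2pi_le) auto
    then have s: "sin x \<ge> 1 / 2" using sin_ge_half[of 1] by simp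
    have "\<bar>?u n\<bar> * sin x = \<bar>sin (real (Suc n) * x)\<bar>"
      using s by (intro abs_cheb_sin) simp
    then have "\<bar>?u n\<bar> * sin x \<le> 1" by simp
    moreover have "\<bar>?u n\<bar> * (1 / 2) \<le> \<bar>?u n\<bar> * sin x" using s by (intro mult_left_mono) auto
    moreover have "1 \<le> ?K" using K[of "{0}"] by simp
    ultimately show ?thesis by linarith
  next
    case 2
    have s: "sin x > 0" "sin x \<le> x" "x / 2 \<le> sin x"
      using 2 sin_ge_half[of x] sin_x_le_x[of x] by auto
    \<comment> \<open>The number of indices k up to n with (k + 1) x at most 1.\<close>
    define M where "M = min (n + 1) (nat \<lfloor>1 / x\<rfloor>)"
    have M: "real M * x \<le> 1"
    proof -
      have "real M \<le> 1 / x" using 2 by (simp add: M_def min_def) linarith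
      then show ?thesis using 2 by (simp add: field_simps)
    qed
    have "1 / 4 \<le> (?u k)\<^sup>2 / (real (k + 1))\<^sup>2" if "k < M" for k
    proof -
      define N where "N = real (k + 1)"
      have "N > 0" "N \<le> real M" using that by (auto simp: N_def)
      then have "N * x \<le> real M * x" using 2 by (intro mult_right_mono) auto
      with M have "N * x \<le> 1" by linarith
      then have "N * x / 2 \<le> sin (N * x)"
        using 2 \<open>N > 0\<close> by (intro sin_ge_half) auto
      moreover have "sin (N * x) = ?u k * sin x" by (simp add: N_def cheb_sin)
      moreover have "N * sin x \<le> N * x"
        using s \<open>N > 0\<close> by (intro mult_left_mono) auto
      ultimately have "(N / 2) * sin x \<le> ?u k * sin x" by linarith
      then have "N / 2 \<le> ?u k" by (rule mult_right_le_imp_le) (rule s)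
      then have "(N / 2)\<^sup>2 \<le> (?u k)\<^sup>2" using \<open>N > 0\<close> by (intro power_mono) auto
      then show ?thesis unfolding N_def[symmetric] using \<open>N > 0\<close>
        by (simp add: power_divide le_divide_eq)
    qed
    then have "(\<Sum>k<M. 1 / 4) \<le> (\<Sum>k<M. (?u k)\<^sup>2 / (real (k + 1))\<^sup>2)"
      by (intro sum_mono) auto
    also have "\<dots> \<le> ?K" by (rule K) (auto simp: M_def)
    finally have 4: "4 * real M \<le> 16 * ?K" by simp
    have u: "\<bar>?u n\<bar> * sin x = \<bar>sin (real (Suc n) * x)\<bar>"
      using s by (intro abs_cheb_sin) simp
    have half: "\<bar>?u n\<bar> * (x / 2) \<le> \<bar>?u n\<bar> * sin x" using s by (intro mult_left_mono) auto
    \<comment> \<open>Since sin x is at least x / 2, both 2 (n + 1) and 2 / x bound the character;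
      the minimum in \<open>M\<close> decides which of them is used.\<close>
    have "\<bar>?u n\<bar> \<le> 4 * real M"
    proof (cases "n + 1 \<le> nat \<lfloor>1 / x\<rfloor>")
      case True
      then have "M = n + 1" by (simp add: M_def)
      have "\<bar>?u n\<bar> * (x / 2) \<le> \<bar>real (Suc n) * x\<bar>"
        using half u abs_sin_x_le_abs_x[of "real (Suc n) * x"] by linarith
      also have "\<dots> = 2 * real (Suc n) * (x / 2)" using 2 by (simp del: of_nat_Suc)
      finally have "\<bar>?u n\<bar> \<le> 2 * real (Suc n)" using 2 by (simp del: of_nat_Suc)
      then show ?thesis by (simp add: \<open>M = n + 1\<close>)
    next
      case False
      then have Mx: "M = nat \<lfloor>1 / x\<rfloor>" by (simp add: M_def)
      have "y / 2 \<le> real (nat \<lfloor>y\<rfloor>)" if "y \<ge> 1" for y :: real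
      proof -
        have "\<lfloor>y\<rfloor> \<ge> 1" using that by simp
        then have "real (nat \<lfloor>y\<rfloor>) = real_of_int \<lfloor>y\<rfloor>" "real_of_int \<lfloor>y\<rfloor> \<ge> 1" by simp_all
        then show ?thesis using real_of_int_floor_add_one_gt[of y] by linarith
      qed
      from this[of "1 / x"] have "1 / x / 2 \<le> real M" unfolding Mx using 2 by simp
      then have "2 / x \<le> 4 * real M" using 2 by (simp add: field_simps)
      have "\<bar>?u n\<bar> * (x / 2) \<le> 1" using half u abs_sin_le_one[of "real (Suc n) * x"] by linarith
      then have "\<bar>?u n\<bar> \<le> 2 / x" using 2 by (simp add: field_simps)
      then show ?thesis using \<open>2 / x \<le> 4 * real M\<close> by (rule order_trans)
    qed
    with 4 show ?thesis by linarith
  qed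
qed

lemma cheb_pointwise_bound:
  assumes "\<bar>t\<bar> \<le> 2"
  shows "\<bar>cheb n t\<bar> \<le> 16 * (\<Sum>k\<le>n. (cheb k t)\<^sup>2 / (real (k + 1))\<^sup>2)"
proof -
  define x where "x = arccos (\<bar>t\<bar> / 2)"
  have x: "0 \<le> x" "x \<le> pi / 2" "2 * cos x = \<bar>t\<bar>"
    using assms using arccos_le_pi2[of "\<bar>t\<bar> / 2"] by (auto simp: x_def arccos_lbound)
  have "\<bar>cheb k \<bar>t\<bar>\<bar> = \<bar>cheb k t\<bar>" for k
    by (cases "t \<ge> 0") (auto simp: cheb_minus abs_mult power_abs)
  moreover from this have "(cheb k \<bar>t\<bar>)\<^sup>2 = (cheb k t)\<^sup>2" for k
    by (metis power2_abs)
  ultimately show ?thesis using cheb_pointwise_bound_aux[OF x(1,2), of n] by (simp add: x(3))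
qed

lemma abs_su2_trace_le: "g \<in> carrier SU2 \<Longrightarrow> \<bar>su2_trace g\<bar> \<le> 2"
  using abs_cheb_trace_le[of g 1] by simp

section \<open>Almost everywhere convergence and interchange with the integral\<close>

lemma AE_summable_norm:
  fixes f :: "nat \<Rightarrow> 'a \<Rightarrow> 'b::{banach, second_countable_topology}"
  assumes f: "\<And>n. integrable M (f n)" and s: "summable (\<lambda>n. \<integral>x. norm (f n x) \<partial>M)"
  shows "AE x in M. summable (\<lambda>n. norm (f n x))"
proof -
  have [measurable]: "f n \<in> borel_measurable M" for n by (rule borel_measurable_integrable[OF f])
  have "(\<integral>\<^sup>+x. (\<Sum>n. ennreal (norm (f n x))) \<partial>M) = (\<Sum>n. \<integral>\<^sup>+x. ennreal (norm (f n x)) \<partial>M)"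
    by (rule nn_integral_suminf) simp
  also have "\<dots> = (\<Sum>n. ennreal (\<integral>x. norm (f n x) \<partial>M))"
    using f by (intro suminf_cong nn_integral_eq_integral integrable_norm) auto
  also have "\<dots> \<noteq> \<infinity>"
    using s by (simp add: ennreal_suminf_neq_top)
  finally have "AE x in M. (\<Sum>n. ennreal (norm (f n x))) \<noteq> \<infinity>"
    by (intro nn_integral_PInf_AE) auto
  then show ?thesis
    by eventually_elim (auto intro: summable_suminf_not_top)
qed

text \<open>A power of n is cruder than a logarithm, but d may be as small as desired and the series
  on the right is a constant independent of n.\<close>

lemma sum_inverse_bound:
  fixes d :: real
  assumes "d > 0"
  shows "(\<Sum>k\<le>n. 1 / real (k + 1)) \<le> real (Suc n) powr d * (\<Sum>k. real (Suc k) powr (- 1 - d))"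
proof -
  have "(\<Sum>k\<le>n. 1 / real (k + 1)) \<le> (\<Sum>k\<le>n. real (Suc n) powr d * real (Suc k) powr (- 1 - d))"
  proof (intro sum_mono)
    fix k assume "k \<in> {..n}"
    have "1 / real (k + 1) = real (Suc k) powr d * real (Suc k) powr (- 1 - d)"
      by (simp add: powr_minus_divide flip: powr_add del: of_nat_Suc)
    also have "\<dots> \<le> real (Suc n) powr d * real (Suc k) powr (- 1 - d)"
      using \<open>k \<in> {..n}\<close> assms by (intro mult_right_mono powr_mono2) auto
    finally show "1 / real (k + 1) \<le> real (Suc n) powr d * real (Suc k) powr (- 1 - d)" .
  qed
  also have "\<dots> = real (Suc n) powr d * (\<Sum>k\<le>n. real (Suc k) powr (- 1 - d))"
    by (simp add: sum_distrib_left)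
  also have "\<dots> \<le> real (Suc n) powr d * (\<Sum>k. real (Suc k) powr (- 1 - d))"
    using assms by (intro mult_left_mono sum_le_suminf summable_Suc_powr) auto
  finally show ?thesis .
qed

context SU2_haar
begin

text \<open>The pointwise bound is applied to one of the three factors. Integration then cancels one
  of the two factors k + 1 in each denominator and leaves a harmonic sum.\<close>

lemma integral_abs_cheb_cubed:
  "(\<integral>g. \<bar>cheb n (su2_trace g)\<bar> ^ 3 \<partial>\<mu>) \<le> 16 * (\<Sum>k\<le>n. 1 / real (k + 1))"
proof -
  let ?F = "\<lambda>t. \<Sum>k\<le>n. (cheb n t)\<^sup>2 * (cheb k t)\<^sup>2 / (real (k + 1))\<^sup>2"
  have "(\<integral>g. \<bar>cheb n (su2_trace g)\<bar> ^ 3 \<partial>\<mu>) \<le> (\<integral>g. 16 * ?F (su2_trace g) \<partial>\<mu>)"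
  proof (rule integral_mono)
    fix g assume "g \<in> space \<mu>"
    then have "\<bar>su2_trace g\<bar> \<le> 2" by (simp add: space_haar abs_su2_trace_le)
    let ?t = "su2_trace g"
    have "\<bar>cheb n ?t\<bar> ^ 3 = (cheb n ?t)\<^sup>2 * \<bar>cheb n ?t\<bar>"
      by (simp add: power3_eq_cube power2_eq_square abs_mult)
    also have "\<dots> \<le> (cheb n ?t)\<^sup>2 * (16 * (\<Sum>k\<le>n. (cheb k ?t)\<^sup>2 / (real (k + 1))\<^sup>2))"
      using cheb_pointwise_bound[OF \<open>\<bar>?t\<bar> \<le> 2\<close>, of n] by (intro mult_left_mono) auto
    also have "\<dots> = 16 * ?F ?t" by (simp add: sum_distrib_left mult_ac)
    finally show "\<bar>cheb n ?t\<bar> ^ 3 \<le> 16 * ?F ?t" .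
  qed (auto intro!: integrable_trace_fun continuous_intros)
  also have "\<dots> = 16 * (\<Sum>k\<le>n. (\<integral>g. (cheb n (su2_trace g))\<^sup>2 * (cheb k (su2_trace g))\<^sup>2 \<partial>\<mu>) / (real (k + 1))\<^sup>2)"
  proof -
    have "integrable \<mu> (\<lambda>g. (cheb n (su2_trace g))\<^sup>2 * (cheb k (su2_trace g))\<^sup>2 / (real (k + 1))\<^sup>2)" for k
      by (intro integrable_divide integrable_trace_fun continuous_intros)
    then show ?thesis by simp
  qed
  also have "\<dots> = 16 * (\<Sum>k\<le>n. 1 / real (k + 1))"
  proof -
    have "real (k + 1) / (real (k + 1))\<^sup>2 = 1 / real (k + 1)" for k
      by (simp add: power2_eq_square)
    then show ?thesis by (simp add: integral_cheb_squares del: of_nat_add of_nat_Suc)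
  qed
  finally show ?thesis .
qed

lemma cheb_series:
  fixes w :: complex
  defines "f \<equiv> \<lambda>n g. of_real (cheb n (su2_trace g)) ^ 3 / of_nat (Suc n) powr w"
  assumes w: "Re w > 1"
  shows "AE g in \<mu>. summable (\<lambda>n. norm (f n g))"
    and "integrable \<mu> (\<lambda>g. \<Sum>n. f n g)"
    and "(\<integral>g. (\<Sum>n. f n g) \<partial>\<mu>) = (1 - 2 powr (- w)) * dirichlet_zeta w"
proof -
  have int: "integrable \<mu> (f n)" for n
    unfolding f_def
    by (intro integrable_divide integrable_continuous continuous_intros continuous_on_cheb_trace)
  \<comment> \<open>Half the distance from Re w to 1: the harmonic sum may cost a factor n^d while
    the exponent - Re w + d stays below -1.\<close>
  define d where "d = (Re w - 1) / 2"
  have "d > 0" "- Re w + d < - 1" using w by (auto simp: d_def field_simps)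
  define C where "C = 16 * (\<Sum>k. real (Suc k) powr (- 1 - d))"
  have nf: "norm (f n g) = \<bar>cheb n (su2_trace g)\<bar> ^ 3 * real (Suc n) powr (- Re w)" for n g
    unfolding f_def
    by (simp add: norm_divide norm_power norm_powr_real_powr powr_minus_divide del: of_nat_Suc)
  have le: "(\<integral>g. norm (f n g) \<partial>\<mu>) \<le> C * real (Suc n) powr (- Re w + d)" for n
  proof -
    have "(\<integral>g. norm (f n g) \<partial>\<mu>) =
        (\<integral>g. \<bar>cheb n (su2_trace g)\<bar> ^ 3 \<partial>\<mu>) * real (Suc n) powr (- Re w)"
      unfolding nf by simp
    also have "\<dots> \<le> (16 * (\<Sum>k\<le>n. 1 / real (k + 1))) * real (Suc n) powr (- Re w)"
      by (intro mult_right_mono integral_abs_cheb_cubed) auto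
    also have "\<dots> \<le> (16 * (real (Suc n) powr d * (\<Sum>k. real (Suc k) powr (- 1 - d)))) * real (Suc n) powr (- Re w)"
      using sum_inverse_bound[OF \<open>d > 0\<close>, of n] by (intro mult_right_mono mult_left_mono) auto
    also have "\<dots> = C * real (Suc n) powr (- Re w + d)"
      by (simp only: C_def powr_add mult_ac)
    finally show ?thesis .
  qed
  have "summable (\<lambda>n. C * real (Suc n) powr (- Re w + d))"
    using \<open>- Re w + d < - 1\<close> by (intro summable_mult summable_Suc_powr)
  then have sum: "summable (\<lambda>n. \<integral>g. norm (f n g) \<partial>\<mu>)"
  proof (rule summable_comparison_test'[where N = 0])
    have "0 \<le> (\<integral>g. norm (f n g) \<partial>\<mu>)" for n by (rule Bochner_Integration.integral_nonneg) simp
    then show "norm (\<integral>g. norm (f n g) \<partial>\<mu>) \<le> C * real (Suc n) powr (- Re w + d)" for n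
      using le[of n] by (simp only: real_norm_def abs_of_nonneg)
  qed
  show ae: "AE g in \<mu>. summable (\<lambda>n. norm (f n g))"
    by (rule AE_summable_norm[OF int sum])
  show "integrable \<mu> (\<lambda>g. \<Sum>n. f n g)"
    by (rule integrable_suminf[OF int ae sum])
  have "(\<integral>g. f n g \<partial>\<mu>) = (if even n then 1 / of_nat (Suc n) powr w else 0)" for n
  proof -
    have "(\<integral>g. f n g \<partial>\<mu>) = (\<integral>g. complex_of_real (cheb n (su2_trace g) ^ 3) \<partial>\<mu>) / of_nat (Suc n) powr w"
      by (simp add: f_def)
    also have "(\<integral>g. complex_of_real (cheb n (su2_trace g) ^ 3) \<partial>\<mu>) = of_real (if even n then 1 else 0)"
      unfolding integral_complex_of_real integral_cheb_cubed ..
    finally show ?thesis by simp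
  qed
  then show "(\<integral>g. (\<Sum>n. f n g) \<partial>\<mu>) = (1 - 2 powr (- w)) * dirichlet_zeta w"
    using sums_integral[OF int ae sum] odd_zeta_sums[OF w] sums_unique2 by simp
qed

end

subsection \<open>Schur's lemma and equivalence of representations\<close>

lemma mat_adjoint_index:
  fixes A :: "complex mat"
  assumes "A \<in> carrier_mat n m"
  shows "mat_adjoint A \<in> carrier_mat m n"
    and "i < m \<Longrightarrow> j < n \<Longrightarrow> mat_adjoint A $$ (i, j) = cnj (A $$ (j, i))"
  using assms by (auto simp: mat_adjoint_def mat_of_rows_index conjugate_complex_def)

lemma mult_mat_index:
  assumes "A \<in> carrier_mat n m" "B \<in> carrier_mat m p" "i < n" "j < p"
  shows "(A * B) $$ (i, j) = (\<Sum>l<m. A $$ (i, l) * B $$ (l, j))"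
  using assms by (auto simp: scalar_prod_def lessThan_atLeast0 intro!: sum.cong)

lemma mult_mat_vec_index:
  assumes "A \<in> carrier_mat n m" "v \<in> carrier_vec m" "i < n"
  shows "vec_index (A *\<^sub>v v) i = (\<Sum>l<m. A $$ (i, l) * vec_index v l)"
  using assms by (auto simp: scalar_prod_def lessThan_atLeast0 intro!: sum.cong)

lemma mult_mat_unit_vec:
  fixes A :: "complex mat"
  assumes "A \<in> carrier_mat n m" "j < m"
  shows "A *\<^sub>v unit_vec m j = col A j"
  using assms by (intro eq_vecI) auto

lemma subspace_vec_iff:
  "VectorSpace.subspace class_ring W (module_vec TYPE(complex) n) \<longleftrightarrow>
     W \<subseteq> carrier_vec n \<and> 0\<^sub>v n \<in> W \<and> (\<forall>v\<in>W. \<forall>w\<in>W. v + w \<in> W) \<and> (\<forall>c. \<forall>v\<in>W. c \<cdot>\<^sub>v v \<in> W)"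
proof -
  have "vectorspace class_ring (module_vec TYPE(complex) n)" by (rule vec_vs)
  moreover from this have "Module.module class_ring (module_vec TYPE(complex) n)"
    by (simp add: vectorspace_def)
  ultimately show ?thesis
    unfolding VectorSpace.subspace_def LinearCombinations.submodule_def module_vec_simps
    by (auto simp: class_ring_simps)
qed

lemma irreducible_unitary_repD:
  assumes "irreducible_unitary_rep G \<pi>"
  defines "n \<equiv> rep_degree G \<pi>"
  shows "n > 0"
    and "\<And>g. g \<in> carrier G \<Longrightarrow> \<pi> g \<in> carrier_mat n n"
    and "\<And>g. g \<in> carrier G \<Longrightarrow> \<pi> g * mat_adjoint (\<pi> g) = 1\<^sub>m n"
    and "\<And>g h. g \<in> carrier G \<Longrightarrow> h \<in> carrier G \<Longrightarrow> \<pi> (g \<otimes>\<^bsub>G\<^esub> h) = \<pi> g * \<pi> h"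
    and "\<And>i j. i < n \<Longrightarrow> j < n \<Longrightarrow> continuous_on (carrier G) (\<lambda>g. \<pi> g $$ (i, j))"
    and "\<And>W. W \<subseteq> carrier_vec n \<Longrightarrow> 0\<^sub>v n \<in> W \<Longrightarrow> (\<And>v w. v \<in> W \<Longrightarrow> w \<in> W \<Longrightarrow> v + w \<in> W) \<Longrightarrow>
      (\<And>c v. v \<in> W \<Longrightarrow> c \<cdot>\<^sub>v v \<in> W) \<Longrightarrow> (\<And>g w. g \<in> carrier G \<Longrightarrow> w \<in> W \<Longrightarrow> \<pi> g *\<^sub>v w \<in> W) \<Longrightarrow>
      W = {0\<^sub>v n} \<or> W = carrier_vec n"
  using assms
  by (auto simp: irreducible_unitary_rep_def unitary_rep_def Let_def subspace_vec_iff)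

text \<open>The two products have equal traces, and these are n and m.\<close>

lemma inverse_mat_square:
  fixes A B :: "complex mat"
  assumes A: "A \<in> carrier_mat n m" and B: "B \<in> carrier_mat m n"
    and "A * B = 1\<^sub>m n" "B * A = 1\<^sub>m m"
  shows "n = m"
proof -
  have "of_nat n = (\<Sum>i<n. (A * B) $$ (i, i))" using assms(3) by simp
  also have "\<dots> = (\<Sum>i<n. \<Sum>l<m. A $$ (i, l) * B $$ (l, i))"
    by (intro sum.cong) (simp_all add: mult_mat_index[OF A B])
  also have "\<dots> = (\<Sum>l<m. \<Sum>i<n. B $$ (l, i) * A $$ (i, l))"
    by (subst sum.swap) (simp add: mult.commute)
  also have "\<dots> = (\<Sum>l<m. (B * A) $$ (l, l))"
    by (intro sum.cong) (simp_all add: mult_mat_index[OF B A])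
  also have "\<dots> = (of_nat m :: complex)" using assms(4) by simp
  finally show ?thesis by simp
qed

lemma zero_mult_vec: "A \<in> carrier_mat n m \<Longrightarrow> A *\<^sub>v 0\<^sub>v m = 0\<^sub>v n" for A :: "complex mat"
  by (intro eq_vecI) auto

text \<open>Kernel and range of \<open>T\<close> are invariant, so irreducibility makes a nonzero
  \<open>T\<close> bijective. Equality of the degrees comes out as a consequence.\<close>

lemma Schur_lemma:
  fixes T :: "complex mat"
  assumes \<pi>: "irreducible_unitary_rep G \<pi>" and \<sigma>: "irreducible_unitary_rep G \<sigma>"
  defines "n \<equiv> rep_degree G \<pi>" and "m \<equiv> rep_degree G \<sigma>"
  assumes T: "T \<in> carrier_mat m n" and comm: "\<And>g. g \<in> carrier G \<Longrightarrow> T * \<pi> g = \<sigma> g * T"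
    and nz: "T \<noteq> 0\<^sub>m m n"
  shows "(\<pi>, \<sigma>) \<in> rep_equiv G"
proof -
  note \<pi>D = irreducible_unitary_repD[OF \<pi>, folded n_def]
  note \<sigma>D = irreducible_unitary_repD[OF \<sigma>, folded m_def]
  have commv: "T *\<^sub>v (\<pi> g *\<^sub>v v) = \<sigma> g *\<^sub>v (T *\<^sub>v v)" if "g \<in> carrier G" "v \<in> carrier_vec n" for g v
    using comm[OF that(1)] that T \<pi>D(2)[OF that(1)] \<sigma>D(2)[OF that(1)]
    by (metis assoc_mult_mat_vec)
  define K where "K = {v \<in> carrier_vec n. T *\<^sub>v v = 0\<^sub>v m}"
  define R where "R = (\<lambda>v. T *\<^sub>v v) ` carrier_vec n"
  have not_all: "K \<noteq> carrier_vec n"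
  proof
    assume K: "K = carrier_vec n"
    have "T = 0\<^sub>m m n"
    proof (rule eq_matI)
      fix i j assume "i < dim_row (0\<^sub>m m n)" "j < dim_col (0\<^sub>m m n)"
      then have ij: "i < m" "j < n" by auto
      have "unit_vec n j \<in> K" unfolding K by simp
      then have "T *\<^sub>v unit_vec n j = 0\<^sub>v m" unfolding K_def by simp
      then have "vec_index (col T j) i = 0" using ij mult_mat_unit_vec[OF T ij(2)] by simp
      then show "T $$ (i, j) = 0\<^sub>m m n $$ (i, j)" using ij T by auto
    qed (use T in auto)
    with nz show False by simp
  qed
  have "K = {0\<^sub>v n} \<or> K = carrier_vec n"
  proof (rule \<pi>D(6))
    show "\<pi> g *\<^sub>v w \<in> K" if "g \<in> carrier G" "w \<in> K" for g w
      using that commv[OF that(1), of w] \<pi>D(2)[OF that(1)] zero_mult_vec[OF \<sigma>D(2)[OF that(1)]]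
      by (auto simp: K_def)
    show "v + w \<in> K" if "v \<in> K" "w \<in> K" for v w
      using that T by (auto simp: K_def mult_add_distrib_mat_vec)
    show "c \<cdot>\<^sub>v v \<in> K" if "v \<in> K" for c v
      using that T by (auto simp: K_def mult_mat_vec)
  qed (use T in \<open>auto simp: K_def zero_mult_vec\<close>)
  with not_all have K: "K = {0\<^sub>v n}" by simp
  have "R = {0\<^sub>v m} \<or> R = carrier_vec m"
  proof (rule \<sigma>D(6))
    show "\<sigma> g *\<^sub>v w \<in> R" if "g \<in> carrier G" "w \<in> R" for g w
    proof -
      from that obtain v where v: "v \<in> carrier_vec n" "w = T *\<^sub>v v" by (auto simp: R_def)
      then have "\<sigma> g *\<^sub>v w = T *\<^sub>v (\<pi> g *\<^sub>v v)" using commv[OF that(1)] by simp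
      then show ?thesis unfolding R_def using \<pi>D(2)[OF that(1)] v by auto
    qed
    show "v + w \<in> R" if "v \<in> R" "w \<in> R" for v w
    proof -
      from that obtain v' w' where "v' \<in> carrier_vec n" "v = T *\<^sub>v v'" "w' \<in> carrier_vec n" "w = T *\<^sub>v w'"
        by (auto simp: R_def)
      then show ?thesis unfolding R_def using T
        by (intro image_eqI[of _ _ "v' + w'"]) (auto simp: mult_add_distrib_mat_vec)
    qed
    show "c \<cdot>\<^sub>v v \<in> R" if "v \<in> R" for c v
    proof -
      from that obtain v' where "v' \<in> carrier_vec n" "v = T *\<^sub>v v'" by (auto simp: R_def)
      then show ?thesis unfolding R_def using T
        by (intro image_eqI[of _ _ "c \<cdot>\<^sub>v v'"]) (auto simp: mult_mat_vec)
    qed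
    show "0\<^sub>v m \<in> R" unfolding R_def using zero_mult_vec[OF T]
      by (intro image_eqI[of _ _ "0\<^sub>v n"]) auto
  qed (use T in \<open>auto simp: R_def\<close>)
  moreover have "R \<noteq> {0\<^sub>v m}"
  proof
    assume "R = {0\<^sub>v m}"
    then have "T *\<^sub>v v = 0\<^sub>v m" if "v \<in> carrier_vec n" for v
      using that unfolding R_def by blast
    then have "K = carrier_vec n" unfolding K_def by blast
    with not_all show False ..
  qed
  ultimately have R: "R = carrier_vec m" by simp
  have "\<exists>v. v \<in> carrier_vec n \<and> T *\<^sub>v v = unit_vec m i" if "i < m" for i
  proof -
    have "unit_vec m i \<in> R" unfolding R by simp
    then show ?thesis by (auto simp: R_def)
  qed
  then obtain f where f: "\<And>i. i < m \<Longrightarrow> f i \<in> carrier_vec n \<and> T *\<^sub>v f i = unit_vec m i" by metis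
  \<comment> \<open>A right inverse of \<open>T\<close>: its columns are preimages of the basis
    vectors.\<close>
  define S where "S = Matrix.mat n m (\<lambda>(i, j). vec_index (f j) i)"
  have S: "S \<in> carrier_mat n m" by (simp add: S_def)
  have colS: "col S j = f j" if "j < m" for j
    using f[OF that] that by (intro eq_vecI) (auto simp: S_def)
  have TS: "T * S = 1\<^sub>m m"
  proof (rule eq_matI)
    fix i j assume "i < dim_row (1\<^sub>m m)" "j < dim_col (1\<^sub>m m)"
    then have ij: "i < m" "j < m" by auto
    have "(T * S) $$ (i, j) = vec_index (T *\<^sub>v col S j) i" using ij T S by auto
    also have "\<dots> = 1\<^sub>m m $$ (i, j)" using colS[OF ij(2)] f[OF ij(2)] ij by auto
    finally show "(T * S) $$ (i, j) = 1\<^sub>m m $$ (i, j)" .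
  qed (use T S in auto)
  have ST: "S * T = 1\<^sub>m n"
  proof -
    have D: "S * T - 1\<^sub>m n \<in> carrier_mat n n" using S T by auto
    \<comment> \<open>The columns of S T - 1 lie in the kernel of \<open>T\<close>, which is zero;
      so the right inverse is also a left inverse.\<close>
    have "T * (S * T - 1\<^sub>m n) = T * (S * T) - T * 1\<^sub>m n"
      using S T by (intro mult_minus_distrib_mat) auto
    also have "T * (S * T) = T * S * T" using S T by (simp add: assoc_mult_mat[OF T S T])
    finally have TD: "T * (S * T - 1\<^sub>m n) = 0\<^sub>m m n" using T by (simp add: TS)
    show ?thesis
    proof (rule eq_matI)
      fix i j assume "i < dim_row (1\<^sub>m n)" "j < dim_col (1\<^sub>m n)"
      then have ij: "i < n" "j < n" by auto
      have "T *\<^sub>v col (S * T - 1\<^sub>m n) j = col (T * (S * T - 1\<^sub>m n)) j"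
        using T D ij by (intro eq_vecI) auto
      also have "\<dots> = 0\<^sub>v m" unfolding TD using ij by (intro eq_vecI) auto
      finally have "col (S * T - 1\<^sub>m n) j \<in> K" using D ij by (auto simp: K_def)
      then have "col (S * T - 1\<^sub>m n) j = 0\<^sub>v n" by (simp add: K)
      then have "vec_index (col (S * T - 1\<^sub>m n) j) i = 0" using ij by simp
      then show "(S * T) $$ (i, j) = 1\<^sub>m n $$ (i, j)" using ij S T by auto
    qed (use S T in auto)
  qed
  have "m = n" by (rule inverse_mat_square[OF T S TS ST])
  moreover have "invertible_mat T"
    unfolding invertible_mat_def inverts_mat_def using T S TS ST \<open>m = n\<close> by auto
  ultimately show ?thesis
    unfolding rep_equiv_def using \<pi> \<sigma> T comm by (auto simp: n_def m_def)
qed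

lemma rep_equivE:
  assumes "(\<pi>, \<sigma>) \<in> rep_equiv G"
  defines "n \<equiv> rep_degree G \<pi>"
  obtains T S where "irreducible_unitary_rep G \<pi>" "irreducible_unitary_rep G \<sigma>"
    "rep_degree G \<sigma> = n" "T \<in> carrier_mat n n" "S \<in> carrier_mat n n"
    "T * S = 1\<^sub>m n" "S * T = 1\<^sub>m n" "\<forall>g\<in>carrier G. T * \<pi> g = \<sigma> g * T"
proof -
  from assms obtain T where T: "irreducible_unitary_rep G \<pi>" "irreducible_unitary_rep G \<sigma>"
    "rep_degree G \<sigma> = n" "T \<in> carrier_mat n n" "invertible_mat T"
    "\<forall>g\<in>carrier G. T * \<pi> g = \<sigma> g * T"
    by (auto simp: rep_equiv_def)
  then obtain S where S: "T * S = 1\<^sub>m (dim_row T)" "S * T = 1\<^sub>m (dim_row S)"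
    by (auto simp: invertible_mat_def inverts_mat_def)
  have "dim_col (S * T) = n" using T by simp
  then have "dim_row S = n" unfolding S(2) by simp
  moreover have "dim_col (T * S) = dim_col S" by simp
  then have "dim_col S = n" unfolding S(1) using T by simp
  ultimately show ?thesis using that[of T S] T S by auto
qed

text \<open>The right inverse shows that \<open>T\<close> is nonzero, as the degree is positive;
  Schur's lemma does the rest.\<close>

lemma rep_equiv_nonzero_intertwinerI:
  assumes "irreducible_unitary_rep G \<pi>" "irreducible_unitary_rep G \<sigma>"
    "T \<in> carrier_mat (rep_degree G \<sigma>) (rep_degree G \<pi>)"
    "S \<in> carrier_mat (rep_degree G \<pi>) (rep_degree G \<sigma>)" "T * S = 1\<^sub>m (rep_degree G \<sigma>)"
    "\<And>g. g \<in> carrier G \<Longrightarrow> T * \<pi> g = \<sigma> g * T"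
  shows "(\<pi>, \<sigma>) \<in> rep_equiv G"
proof (rule Schur_lemma[OF assms(1-3,6)])
  show "T \<noteq> 0\<^sub>m (rep_degree G \<sigma>) (rep_degree G \<pi>)"
  proof
    assume "T = 0\<^sub>m (rep_degree G \<sigma>) (rep_degree G \<pi>)"
    then have "1\<^sub>m (rep_degree G \<sigma>) = (0\<^sub>m (rep_degree G \<sigma>) (rep_degree G \<sigma>) :: complex mat)"
      using assms(4,5) by simp
    then have "(1\<^sub>m (rep_degree G \<sigma>) :: complex mat) $$ (0, 0) =
        0\<^sub>m (rep_degree G \<sigma>) (rep_degree G \<sigma>) $$ (0, 0)" by simp
    then show False using irreducible_unitary_repD(1)[OF assms(2)] by simp
  qed
qed

lemma equiv_rep_equiv: "equiv {\<pi>. irreducible_unitary_rep G \<pi>} (rep_equiv G)"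
proof (rule equivI)
  show "rep_equiv G \<subseteq> {\<pi>. irreducible_unitary_rep G \<pi>} \<times> {\<pi>. irreducible_unitary_rep G \<pi>}"
    by (auto simp: rep_equiv_def)
  show "refl_on {\<pi>. irreducible_unitary_rep G \<pi>} (rep_equiv G)"
  proof (rule refl_onI)
    fix \<pi> assume "\<pi> \<in> {\<pi>. irreducible_unitary_rep G \<pi>}"
    then have \<pi>: "irreducible_unitary_rep G \<pi>" by simp
    show "(\<pi>, \<pi>) \<in> rep_equiv G"
    proof (rule rep_equiv_nonzero_intertwinerI[OF \<pi> \<pi>, of "1\<^sub>m (rep_degree G \<pi>)" "1\<^sub>m (rep_degree G \<pi>)"])
      show "1\<^sub>m (rep_degree G \<pi>) * \<pi> g = \<pi> g * 1\<^sub>m (rep_degree G \<pi>)" if "g \<in> carrier G" for g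
        using irreducible_unitary_repD(2)[OF \<pi> that] by simp
    qed auto
  qed
  show "sym (rep_equiv G)"
  proof (rule symI)
    fix \<pi> \<sigma> assume "(\<pi>, \<sigma>) \<in> rep_equiv G"
    then obtain T S where *: "irreducible_unitary_rep G \<pi>" "irreducible_unitary_rep G \<sigma>"
      "rep_degree G \<sigma> = rep_degree G \<pi>" "T \<in> carrier_mat (rep_degree G \<pi>) (rep_degree G \<pi>)"
      "S \<in> carrier_mat (rep_degree G \<pi>) (rep_degree G \<pi>)"
      "T * S = 1\<^sub>m (rep_degree G \<pi>)" "S * T = 1\<^sub>m (rep_degree G \<pi>)"
      "\<forall>g\<in>carrier G. T * \<pi> g = \<sigma> g * T"
      by (rule rep_equivE) blast
    let ?n = "rep_degree G \<pi>"
    have "S * \<sigma> g = \<pi> g * S" if "g \<in> carrier G" for g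
    proof -
      have \<pi>g: "\<pi> g \<in> carrier_mat ?n ?n" and \<sigma>g: "\<sigma> g \<in> carrier_mat ?n ?n"
        using irreducible_unitary_repD(2)[OF *(1) that] irreducible_unitary_repD(2)[OF *(2) that] *(3) by auto
      have "S * \<sigma> g = S * \<sigma> g * (T * S)" using * \<sigma>g by simp
      also have "\<dots> = S * (\<sigma> g * T) * S"
        using * \<sigma>g by (simp add: assoc_mult_mat[of _ ?n ?n _ ?n _ ?n])
      also have "\<dots> = S * (T * \<pi> g) * S" using bspec[OF *(8) that] by simp
      also have "\<dots> = (S * T) * \<pi> g * S"
        using *(4,5) \<pi>g by (simp add: assoc_mult_mat[of _ ?n ?n _ ?n _ ?n])
      also have "\<dots> = \<pi> g * S" using * \<pi>g by simp
      finally show ?thesis .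
    qed
    then show "(\<sigma>, \<pi>) \<in> rep_equiv G"
      using * by (intro rep_equiv_nonzero_intertwinerI[of _ _ _ S T]) auto
  qed
  show "trans (rep_equiv G)"
  proof (rule transI)
    fix \<pi> \<sigma> \<tau> assume "(\<pi>, \<sigma>) \<in> rep_equiv G" "(\<sigma>, \<tau>) \<in> rep_equiv G"
    let ?n = "rep_degree G \<pi>"
    from \<open>(\<pi>, \<sigma>) \<in> rep_equiv G\<close> obtain T S where *: "irreducible_unitary_rep G \<pi>"
      "irreducible_unitary_rep G \<sigma>"
      "rep_degree G \<sigma> = ?n" "T \<in> carrier_mat ?n ?n"
      "S \<in> carrier_mat ?n ?n"
      "T * S = 1\<^sub>m ?n" "S * T = 1\<^sub>m ?n"
      "\<forall>g\<in>carrier G. T * \<pi> g = \<sigma> g * T"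
      by (rule rep_equivE) blast
    from \<open>(\<sigma>, \<tau>) \<in> rep_equiv G\<close> obtain T' S' where **: "irreducible_unitary_rep G \<tau>"
      "rep_degree G \<tau> = ?n" "T' \<in> carrier_mat ?n ?n"
      "S' \<in> carrier_mat ?n ?n"
      "T' * S' = 1\<^sub>m ?n" "S' * T' = 1\<^sub>m ?n"
      "\<forall>g\<in>carrier G. T' * \<sigma> g = \<tau> g * T'"
      using *(3) by (elim rep_equivE) auto
    note [simp] = assoc_mult_mat[of _ ?n ?n _ ?n _ ?n]
    show "(\<pi>, \<tau>) \<in> rep_equiv G"
    proof (rule rep_equiv_nonzero_intertwinerI[OF *(1) **(1), of "T' * T" "S * S'"])
      have "(T' * T) * (S * S') = T' * (T * S) * S'"
        using *(4,5) **(3,4) by simp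
      then show "(T' * T) * (S * S') = 1\<^sub>m (rep_degree G \<tau>)"
        using * ** by simp
      fix g assume g: "g \<in> carrier G"
      have c: "\<pi> g \<in> carrier_mat ?n ?n" "\<sigma> g \<in> carrier_mat ?n ?n" "\<tau> g \<in> carrier_mat ?n ?n"
        using irreducible_unitary_repD(2)[OF *(1) g] irreducible_unitary_repD(2)[OF *(2) g]
          irreducible_unitary_repD(2)[OF **(1) g] *(3) **(2) by auto
      have "(T' * T) * \<pi> g = T' * (T * \<pi> g)" using *(4) **(3) c by simp
      also have "\<dots> = (T' * \<sigma> g) * T" using *(4) **(3) c bspec[OF *(8) g] by simp
      also have "\<dots> = \<tau> g * (T' * T)" using *(4) **(3) c bspec[OF **(7) g] by simp
      finally show "(T' * T) * \<pi> g = \<tau> g * (T' * T)" .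
    qed (use * ** in auto)
  qed
qed

lemma mat_trace_mult_commute:
  assumes A: "A \<in> carrier_mat n m" and B: "B \<in> carrier_mat m n"
  shows "mat_trace (A * B) = mat_trace (B * A)"
proof -
  have "mat_trace (A * B) = (\<Sum>i<n. \<Sum>l<m. A $$ (i, l) * B $$ (l, i))"
    unfolding mat_trace_def using A B by (intro sum.cong) (auto simp: mult_mat_index[OF A B] simp del: index_mult_mat(1))
  also have "\<dots> = (\<Sum>l<m. \<Sum>i<n. B $$ (l, i) * A $$ (i, l))"
    by (subst sum.swap) (simp add: mult.commute)
  also have "\<dots> = mat_trace (B * A)"
    unfolding mat_trace_def using A B by (intro sum.cong) (auto simp: mult_mat_index[OF B A] simp del: index_mult_mat(1))
  finally show ?thesis .
qed

lemma rep_equiv_trace: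
  assumes "(\<pi>, \<sigma>) \<in> rep_equiv G" "g \<in> carrier G"
  shows "mat_trace (\<pi> g) = mat_trace (\<sigma> g)"
proof -
  let ?n = "rep_degree G \<pi>"
  from assms(1) obtain T S where *: "irreducible_unitary_rep G \<pi>" "irreducible_unitary_rep G \<sigma>"
      "rep_degree G \<sigma> = ?n" "T \<in> carrier_mat ?n ?n" "S \<in> carrier_mat ?n ?n"
      "T * S = 1\<^sub>m ?n" "S * T = 1\<^sub>m ?n" "\<forall>g\<in>carrier G. T * \<pi> g = \<sigma> g * T"
    by (rule rep_equivE)
  have \<pi>g: "\<pi> g \<in> carrier_mat ?n ?n" and \<sigma>g: "\<sigma> g \<in> carrier_mat ?n ?n"
    using irreducible_unitary_repD(2)[OF *(1) assms(2)] irreducible_unitary_repD(2)[OF *(2) assms(2)] *(3)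
    by auto
  note [simp] = assoc_mult_mat[of _ ?n ?n _ ?n _ ?n]
  have "mat_trace (\<pi> g) = mat_trace ((S * T) * \<pi> g)" using * \<pi>g by simp
  also have "\<dots> = mat_trace (S * (\<sigma> g * T))" using *(4,5) \<pi>g bspec[OF *(8) assms(2)] by simp
  also have "\<dots> = mat_trace ((\<sigma> g * T) * S)"
    using *(4,5) \<sigma>g by (intro mat_trace_mult_commute) auto
  also have "\<dots> = mat_trace (\<sigma> g)" using * \<sigma>g by simp
  finally show ?thesis .
qed

lemma rep_equiv_degree: "(\<pi>, \<sigma>) \<in> rep_equiv G \<Longrightarrow> rep_degree G \<pi> = rep_degree G \<sigma>"
  by (simp add: rep_equiv_def)

subsection \<open>The unitary dual of SU(2)\<close>

text \<open>Conjugate of \<open>sym_power k\<close> by a diagonal matrix: the orthonormal basis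
  gives the unitary matrices that \<open>unitary_rep\<close> asks for and keeps the traces.\<close>

definition sym_rep :: "nat \<Rightarrow> complex^2^2 \<Rightarrow> complex mat" where
  "sym_rep k g = Matrix.mat (k + 1) (k + 1) (\<lambda>(i, j). unitary_sym_coeff k g i j)"

lemma sym_rep_carrier [simp]: "sym_rep k g \<in> carrier_mat (k + 1) (k + 1)"
  by (simp add: sym_rep_def)

lemma sym_rep_dim [simp]: "dim_row (sym_rep k g) = k + 1" "dim_col (sym_rep k g) = k + 1"
  by (simp_all add: sym_rep_def)

lemma sym_rep_index [simp]:
  "i \<le> k \<Longrightarrow> j \<le> k \<Longrightarrow> sym_rep k g $$ (i, j) = unitary_sym_coeff k g i j"
  by (simp add: sym_rep_def)

lemma rep_degree_sym_rep [simp]: "rep_degree SU2 (sym_rep k) = k + 1"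
  by (simp add: rep_degree_def sym_rep_def)

lemma continuous_on_unitary_sym_coeff: "continuous_on S (\<lambda>g. unitary_sym_coeff k g i j)"
proof (cases "binom_norm k i = 0")
  case False
  then show ?thesis
    unfolding unitary_sym_coeff_def by (intro continuous_intros continuous_on_sym_coeff) (simp add: False)
qed (simp add: unitary_sym_coeff_def)

lemma unitary_rep_sym_rep: "unitary_rep SU2 (sym_rep k)"
proof -
  have "sym_rep k g * mat_adjoint (sym_rep k g) = 1\<^sub>m (k + 1)" if "g \<in> carrier SU2" for g
  proof (rule eq_matI)
    fix i j assume "i < dim_row (1\<^sub>m (k + 1) :: complex mat)" "j < dim_col (1\<^sub>m (k + 1) :: complex mat)"
    then have ij: "i \<le> k" "j \<le> k" by auto
    have "(sym_rep k g * mat_adjoint (sym_rep k g)) $$ (i, j) =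
        (\<Sum>l<k + 1. sym_rep k g $$ (i, l) * mat_adjoint (sym_rep k g) $$ (l, j))"
      using ij by (intro mult_mat_index[OF sym_rep_carrier mat_adjoint_index(1)[OF sym_rep_carrier]]) auto
    also have "\<dots> = (\<Sum>l\<le>k. unitary_sym_coeff k g i l * cnj (unitary_sym_coeff k g j l))"
      using ij by (intro sum.cong) (auto simp: mat_adjoint_index(2)[OF sym_rep_carrier])
    finally show "(sym_rep k g * mat_adjoint (sym_rep k g)) $$ (i, j) = 1\<^sub>m (k + 1) $$ (i, j)"
      using ij unitary_sym_coeff_unitary[OF that ij] by simp
  qed (use mat_adjoint_index(1)[OF sym_rep_carrier[of k g]] in auto)
  moreover have "sym_rep k (g ** h) = sym_rep k g * sym_rep k h" for g h
  proof (rule eq_matI)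
    fix i j assume "i < dim_row (sym_rep k g * sym_rep k h)" "j < dim_col (sym_rep k g * sym_rep k h)"
    then have ij: "i \<le> k" "j \<le> k" by (auto simp: sym_rep_def)
    then show "sym_rep k (g ** h) $$ (i, j) = (sym_rep k g * sym_rep k h) $$ (i, j)"
      by (simp add: mult_mat_index[OF sym_rep_carrier sym_rep_carrier] unitary_sym_coeff_mult
          lessThan_Suc_atMost del: index_mult_mat(1))
  qed (auto simp: sym_rep_def)
  moreover have "continuous_on (carrier SU2) (\<lambda>g. sym_rep k g $$ (i, j))" if "i \<le> k" "j \<le> k" for i j
    using that by (simp add: continuous_on_unitary_sym_coeff)
  ultimately show ?thesis
    unfolding unitary_rep_def Let_def rep_degree_sym_rep by (auto simp: less_Suc_eq_le)
qed

text \<open>The action of the diagonal torus separates the basis vectors, so an invariant subspace is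
  spanned by basis vectors.\<close>

lemma unit_vec_in_invariant:
  assumes sub: "W \<subseteq> carrier_vec (k + 1)" "\<And>v w. v \<in> W \<Longrightarrow> w \<in> W \<Longrightarrow> v + w \<in> W"
    "\<And>c v. v \<in> W \<Longrightarrow> c \<cdot>\<^sub>v v \<in> W"
    and inv: "\<And>g w. g \<in> carrier SU2 \<Longrightarrow> w \<in> W \<Longrightarrow> sym_rep k g *\<^sub>v w \<in> W"
    and w: "w \<in> W" and j: "j \<le> k" "vec_index w j \<noteq> 0"
  shows "unit_vec (k + 1) j \<in> W"
  using w j(2)
proof (induction "card {i. i \<le> k \<and> vec_index w i \<noteq> 0}" arbitrary: w rule: less_induct)
  case less
  have wc: "w \<in> carrier_vec (k + 1)" using less.prems(1) sub(1) by blast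
  show ?case
  proof (cases "\<exists>i\<le>k. i \<noteq> j \<and> vec_index w i \<noteq> 0")
    case False
    have "unit_vec (k + 1) j = (1 / vec_index w j) \<cdot>\<^sub>v w"
      using wc less.prems(2) False j(1) by (intro eq_vecI) (auto simp: less_Suc_eq_le unit_vec_def)
    then show ?thesis using sub(3)[OF less.prems(1)] by simp
  next
    case True
    then obtain i where i: "i \<le> k" "i \<noteq> j" "vec_index w i \<noteq> 0" by blast
    define d where "d = real i - real j"
    have d: "d \<noteq> 0" using i by (simp add: d_def)
    \<comment> \<open>At this angle the torus eigenvalues for i and j are opposite, hence
      distinct.\<close>
    define a where "a = pi / (2 * d)"
    define z where "z = cis a"
    define ev where "ev = (\<lambda>l. z ^ (k - l) * cnj z ^ l)"
    have zC: "su2 z 0 \<in> carrier SU2"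
      by (intro su2_in_SU2) (simp add: z_def cis_cnj cis_mult)
    have ev: "ev l = cis ((real k - 2 * real l) * a)" if "l \<le> k" for l
    proof -
      have "ev l = cis (real (k - l) * a - real l * a)"
        by (simp only: ev_def z_def cis_cnj Complex.DeMoivre cis_mult mult_minus_right add_uminus_conv_diff)
      also have "real (k - l) * a - real l * a = (real k - 2 * real l) * a"
        using that by (simp add: of_nat_diff algebra_simps)
      finally show ?thesis .
    qed
    have "2 * d * a = pi" using d by (simp add: a_def)
    then have "(real k - 2 * real j) * a = (real k - 2 * real i) * a + pi"
      by (simp add: d_def algebra_simps)
    then have "ev j = - ev i"
      using ev[OF i(1)] ev[OF j(1)] by (simp flip: cis_mult)
    moreover have "ev i \<noteq> 0" using ev[OF i(1)] by simp
    ultimately have neq: "ev j \<noteq> ev i" by simp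
    \<comment> \<open>Subtracting the eigenvalue at i kills coordinate i and keeps coordinate j
      nonzero, so the support shrinks.\<close>
    define w' where "w' = sym_rep k (su2 z 0) *\<^sub>v w + (- ev i) \<cdot>\<^sub>v w"
    have w'W: "w' \<in> W"
      unfolding w'_def using less.prems(1) zC by (intro sub inv)
    have w': "vec_index w' l = (ev l - ev i) * vec_index w l" if "l \<le> k" for l
    proof -
      have "vec_index (sym_rep k (su2 z 0) *\<^sub>v w) l =
          (\<Sum>m<k + 1. sym_rep k (su2 z 0) $$ (l, m) * vec_index w m)"
        using that by (intro mult_mat_vec_index[OF sym_rep_carrier wc]) simp
      also have "\<dots> = (\<Sum>m<k + 1. if m = l then ev l * vec_index w l else 0)"
        using that
        by (intro sum.cong) (auto simp: unitary_sym_coeff_def sym_coeff_diag ev_def binom_norm)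
      also have "\<dots> = ev l * vec_index w l" using that by simp
      finally show ?thesis
        using that wc by (simp add: w'_def left_diff_distrib del: index_mult_mat_vec)
    qed
    have "{l. l \<le> k \<and> vec_index w' l \<noteq> 0} \<subset> {l. l \<le> k \<and> vec_index w l \<noteq> 0}"
    proof (rule psubsetI)
      show "{l. l \<le> k \<and> vec_index w' l \<noteq> 0} \<subseteq> {l. l \<le> k \<and> vec_index w l \<noteq> 0}"
        using w' by fastforce
      have "vec_index w' i = 0" using w'[OF i(1)] by simp
      then show "{l. l \<le> k \<and> vec_index w' l \<noteq> 0} \<noteq> {l. l \<le> k \<and> vec_index w l \<noteq> 0}"
        using i by blast
    qed
    then have "card {l. l \<le> k \<and> vec_index w' l \<noteq> 0} < card {l. l \<le> k \<and> vec_index w l \<noteq> 0}"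
      by (intro psubset_card_mono) auto
    then show ?thesis
      using less.hyps[OF _ w'W] w'[OF j(1)] neq less.prems(2) by simp
  qed
qed

text \<open>A nonzero invariant subspace contains a basis vector. From it \<open>su2 c c\<close>
  leads to basis vector 0 and from there to all others, because row 0 and column 0 of its matrix
  have no zero entry.\<close>

lemma irreducible_sym_rep: "irreducible_unitary_rep SU2 (sym_rep k)"
proof -
  have "W = {0\<^sub>v (k + 1)} \<or> W = carrier_vec (k + 1)"
    if W: "W \<subseteq> carrier_vec (k + 1)" "0\<^sub>v (k + 1) \<in> W" "\<And>v w. v \<in> W \<Longrightarrow> w \<in> W \<Longrightarrow> v + w \<in> W"
      "\<And>c v. v \<in> W \<Longrightarrow> c \<cdot>\<^sub>v v \<in> W"
      and inv: "\<And>g w. g \<in> carrier SU2 \<Longrightarrow> w \<in> W \<Longrightarrow> sym_rep k g *\<^sub>v w \<in> W" for W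
  proof (rule disjCI)
    assume "W \<noteq> carrier_vec (k + 1)"
    have unit: "unit_vec (k + 1) j \<in> W" if "w \<in> W" "j \<le> k" "vec_index w j \<noteq> 0" for w j
      by (rule unit_vec_in_invariant[of W k w j]) (fact W inv that)+
    define c where "c = complex_of_real (1 / sqrt 2)"
    have c: "c * c = 1 / 2" "cnj c = c" "c \<noteq> 0"
      by (simp_all add: c_def flip: of_real_mult)
    have h: "su2 c c \<in> carrier SU2" by (intro su2_in_SU2) (simp add: c)
    have col: "vec_index (sym_rep k (su2 c c) *\<^sub>v unit_vec (k + 1) j) i = unitary_sym_coeff k (su2 c c) i j"
      if "i \<le> k" "j \<le> k" for i j
      using that by (simp add: mult_mat_unit_vec[OF sym_rep_carrier] sym_rep_def)
    show "W = {0\<^sub>v (k + 1)}"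
    proof (rule ccontr)
      assume "W \<noteq> {0\<^sub>v (k + 1)}"
      then obtain w where w: "w \<in> W" "w \<noteq> 0\<^sub>v (k + 1)" using W(2) by blast
      have "\<exists>j\<le>k. vec_index w j \<noteq> 0"
      proof (rule ccontr)
        assume "\<not> (\<exists>j\<le>k. vec_index w j \<noteq> 0)"
        then have "w = 0\<^sub>v (k + 1)" using w(1) W(1) by (intro eq_vecI) auto
        with w(2) show False ..
      qed
      then obtain j where j: "j \<le> k" "vec_index w j \<noteq> 0" by blast
      have "unit_vec (k + 1) j \<in> W" by (rule unit[OF w(1) j])
      then have "sym_rep k (su2 c c) *\<^sub>v unit_vec (k + 1) j \<in> W" by (rule inv[OF h])
      moreover have "unitary_sym_coeff k (su2 c c) 0 j \<noteq> 0"
        using j c by (simp add: unitary_sym_coeff_def sym_coeff_explicit binom_norm)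
      ultimately have "unit_vec (k + 1) 0 \<in> W"
        using col[of 0 j] j by (intro unit[of "sym_rep k (su2 c c) *\<^sub>v unit_vec (k + 1) j"]) auto
      then have 0: "sym_rep k (su2 c c) *\<^sub>v unit_vec (k + 1) 0 \<in> W" by (rule inv[OF h])
      have units: "unit_vec (k + 1) i \<in> W" if "i \<le> k" for i
      proof (rule unit[OF 0 that])
        have "unitary_sym_coeff k (su2 c c) i 0 \<noteq> 0"
          using that c by (simp add: unitary_sym_coeff_def sym_coeff_def coeff_linear_power_binomial binom_norm)
        then show "vec_index (sym_rep k (su2 c c) *\<^sub>v unit_vec (k + 1) 0) i \<noteq> 0"
          using col[of i 0] that by simp
      qed
      have "v \<in> W" if v: "v \<in> carrier_vec (k + 1)" for v
      proof -
        have "Matrix.vec (k + 1) (\<lambda>i. if i < m then vec_index v i else 0) \<in> W" if "m \<le> k + 1" for m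
          using that
        proof (induction m)
          case 0
          have "Matrix.vec (k + 1) (\<lambda>i. if i < 0 then vec_index v i else 0) = 0\<^sub>v (k + 1)"
            by (intro eq_vecI) auto
          then show ?case using W(2) by simp
        next
          case (Suc m)
          have "Matrix.vec (k + 1) (\<lambda>i. if i < Suc m then vec_index v i else 0) =
              Matrix.vec (k + 1) (\<lambda>i. if i < m then vec_index v i else 0) +
              vec_index v m \<cdot>\<^sub>v unit_vec (k + 1) m"
            using Suc.prems by (intro eq_vecI) (auto simp: less_Suc_eq unit_vec_def)
          then show ?case using Suc W(3,4) units[of m] by simp
        qed
        from this[of "k + 1"] have "Matrix.vec (k + 1) (\<lambda>i. if i < k + 1 then vec_index v i else 0) \<in> W"
          by simp
        also have "Matrix.vec (k + 1) (\<lambda>i. if i < k + 1 then vec_index v i else 0) = v"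
          using v by (intro eq_vecI) auto
        finally show ?thesis .
      qed
      with W(1) \<open>W \<noteq> carrier_vec (k + 1)\<close> show False by blast
    qed
  qed
  then show ?thesis
    unfolding irreducible_unitary_rep_def Let_def rep_degree_sym_rep subspace_vec_iff
    using unitary_rep_sym_rep[of k] by auto
qed

section \<open>Completeness of the symmetric powers\<close>

lemma unitary_entry_le_1:
  fixes A :: "complex mat"
  assumes A: "A \<in> carrier_mat n n" "A * mat_adjoint A = 1\<^sub>m n" and ij: "i < n" "j < n"
  shows "norm (A $$ (i, j)) \<le> 1"
proof -
  have "(A * mat_adjoint A) $$ (i, i) = (\<Sum>l<n. A $$ (i, l) * mat_adjoint A $$ (l, i))"
    using ij by (intro mult_mat_index[OF A(1) mat_adjoint_index(1)[OF A(1)]])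
  also have "\<dots> = (\<Sum>l<n. of_real ((norm (A $$ (i, l)))\<^sup>2))"
    unfolding complex_norm_square using ij
    by (intro sum.cong) (auto simp: mat_adjoint_index(2)[OF A(1)])
  finally have "complex_of_real (\<Sum>l<n. (norm (A $$ (i, l)))\<^sup>2) = 1"
    using ij A(2) by simp
  then have "(\<Sum>l<n. (norm (A $$ (i, l)))\<^sup>2) = 1" by (metis of_real_eq_1_iff)
  moreover have "(norm (A $$ (i, j)))\<^sup>2 \<le> (\<Sum>l<n. (norm (A $$ (i, l)))\<^sup>2)"
    using ij by (intro member_le_sum) auto
  ultimately show ?thesis by (simp add: abs_square_le_1)
qed

text \<open>The image of the unit element is idempotent because \<open>\<pi>\<close> is
  multiplicative, and invertible because it is unitary.\<close>

lemma rep_one: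
  assumes \<pi>: "irreducible_unitary_rep SU2 \<pi>"
  shows "\<pi> (Finite_Cartesian_Product.mat 1) = 1\<^sub>m (rep_degree SU2 \<pi>)"
proof -
  let ?n = "rep_degree SU2 \<pi>" and ?e = "Finite_Cartesian_Product.mat 1 :: complex^2^2"
  note D = irreducible_unitary_repD[OF \<pi>]
  have c: "\<pi> ?e \<in> carrier_mat ?n ?n" "mat_adjoint (\<pi> ?e) \<in> carrier_mat ?n ?n"
    using D(2)[OF one_in_SU2] mat_adjoint_index(1) by auto
  have "\<pi> ?e * \<pi> ?e = \<pi> ?e" using D(4)[OF one_in_SU2 one_in_SU2] by simp
  then have "(\<pi> ?e * \<pi> ?e) * mat_adjoint (\<pi> ?e) = 1\<^sub>m ?n" using D(3)[OF one_in_SU2] by simp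
  then show ?thesis
    using c D(3)[OF one_in_SU2] by (simp add: assoc_mult_mat[of _ ?n ?n _ ?n _ ?n])
qed

lemma su2_trace_near_one:
  assumes "d > 0"
  obtains e where "e > 0" "\<And>g. g \<in> carrier SU2 \<Longrightarrow> su2_trace g > 2 - e \<Longrightarrow>
    dist g (Finite_Cartesian_Product.mat 1) < d"
proof
  \<comment> \<open>On SU(2) the squares of |a - 1| and |b| add up to 2 - tr g, so with this
    constant each of the four entries is within d / 4 of the identity.\<close>
  show "(d / 4)\<^sup>2 > 0" using assms by simp
  fix g assume g: "g \<in> carrier SU2" "su2_trace g > 2 - (d / 4)\<^sup>2"
  obtain a b where ab: "g = su2 a b" "a * cnj a + b * cnj b = 1" using SU2_cases[OF g(1)] by blast
  have norm_sq: "(cmod (a - 1))\<^sup>2 + (cmod b)\<^sup>2 = 2 - su2_trace g"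
  proof -
    have "(Re a)\<^sup>2 + (Im a)\<^sup>2 + (Re b)\<^sup>2 + (Im b)\<^sup>2 = 1"
      using ab(2) by (simp add: complex_eq_iff power2_eq_square)
    then show ?thesis unfolding cmod_power2 by (simp add: su2_trace_def ab(1) power2_diff)
  qed
  have sq: "(cmod (a - 1))\<^sup>2 < (d / 4)\<^sup>2" "(cmod b)\<^sup>2 < (d / 4)\<^sup>2"
    using norm_sq g(2) zero_le_power2[of "cmod (a - 1)"] zero_le_power2[of "cmod b"] by linarith+
  have "0 \<le> d / 4" using assms by simp
  note lt = power2_less_imp_less[OF sq(1) this] power2_less_imp_less[OF sq(2) this]
  let ?x = "g - Finite_Cartesian_Product.mat 1"
  have row: "norm (?x $ i) \<le> (\<Sum>j\<in>UNIV. norm (?x $ i $ j))" for i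
    unfolding norm_vec_def by (intro L2_set_le_sum) auto
  have "norm ?x \<le> (\<Sum>i\<in>UNIV. norm (?x $ i))"
    unfolding norm_vec_def[of ?x] by (intro L2_set_le_sum) auto
  also have "\<dots> \<le> (\<Sum>i\<in>UNIV. \<Sum>j\<in>UNIV. norm (?x $ i $ j))"
    by (intro sum_mono row)
  also have "\<dots> = 2 * cmod (a - 1) + 2 * cmod b"
    using complex_mod_cnj[of "a - 1"] by (simp add: sum_2 ab(1) mat_1_eq_su2)
  finally show "dist g (Finite_Cartesian_Product.mat 1) < d"
    using lt by (simp add: dist_norm)
qed

lemma cheb_mult_as_sum: "\<exists>h. \<forall>t. cheb m t * cheb n t = (\<Sum>l\<le>min m n. cheb (h l) t)"
proof (cases "n \<le> m")
  case True
  then show ?thesis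
    using cheb_Clebsch_Gordan[OF True] by (intro exI[of _ "\<lambda>l. m + n - 2 * l"]) (simp add: min_def)
next
  case False
  then have "m \<le> n" by simp
  then show ?thesis
    using cheb_Clebsch_Gordan[OF \<open>m \<le> n\<close>]
    by (intro exI[of _ "\<lambda>l. n + m - 2 * l"]) (simp add: min_def mult.commute)
qed

text \<open>At t = 2 cos x, the number 4 - t^2 times the squared character is 4 sin^2((n + 1) x),
  while 2 - t is at least e. Away from the identity the weight is thus dominated by the square,
  whose integral does not grow with n.\<close>

lemma cheb_weight_le:
  assumes "\<bar>t\<bar> \<le> 2" "t \<le> 2 - e" "e > 0"
  shows "(2 + t) * cheb n t ^ 4 \<le> 4 / e * (cheb n t)\<^sup>2"
proof -
  define x where "x = arccos (t / 2)"
  have t: "t = 2 * cos x" using assms by (simp add: x_def)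
  have "(2 - t) * (2 + t) * (cheb n t)\<^sup>2 = 4 * (cheb n t * sin x)\<^sup>2"
  proof -
    have "(2 - t) * (2 + t) = 4 - 4 * (cos x)\<^sup>2" by (simp add: t algebra_simps power2_eq_square)
    then have "(2 - t) * (2 + t) = 4 * (sin x)\<^sup>2" by (simp add: sin_squared_eq)
    then show ?thesis by (simp add: power_mult_distrib)
  qed
  also have "\<dots> \<le> 4"
    unfolding t cheb_sin using abs_sin_le_one[of "real (Suc n) * x"] by (simp add: abs_square_le_1)
  finally have "(2 - t) * ((2 + t) * (cheb n t)\<^sup>2) \<le> 4" by (simp add: mult.assoc)
  moreover have "e * ((2 + t) * (cheb n t)\<^sup>2) \<le> (2 - t) * ((2 + t) * (cheb n t)\<^sup>2)"
    using assms by (intro mult_right_mono) auto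
  ultimately have "(2 + t) * (cheb n t)\<^sup>2 \<le> 4 / e"
    using assms(3) by (simp add: field_simps)
  then have "(2 + t) * (cheb n t)\<^sup>2 * (cheb n t)\<^sup>2 \<le> 4 / e * (cheb n t)\<^sup>2"
    by (intro mult_right_mono) auto
  then show ?thesis by (simp add: mult.assoc flip: power_add)
qed

context SU2_haar
begin

text \<open>Averaging \<open>\<pi>(g) B \<rho>(g)\<^sup>*\<close> over the group gives an intertwiner; here \<open>B\<close> is a matrix unit.\<close>

lemma matrix_coeff_orthogonal:
  assumes \<pi>: "irreducible_unitary_rep SU2 \<pi>" and neq: "(sym_rep k, \<pi>) \<notin> rep_equiv SU2"
    and ij: "i < rep_degree SU2 \<pi>" "j < rep_degree SU2 \<pi>" "m \<le> k" "l \<le> k"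
  shows "(\<integral>g. \<pi> g $$ (i, j) * cnj (unitary_sym_coeff k g m l) \<partial>\<mu>) = 0"
proof -
  let ?n = "rep_degree SU2 \<pi>"
  note D = irreducible_unitary_repD[OF \<pi>]
  let ?I = "\<lambda>i m. \<integral>g. \<pi> g $$ (i, j) * cnj (unitary_sym_coeff k g m l) \<partial>\<mu>"
  have int: "integrable \<mu> (\<lambda>g. \<pi> g $$ (i, j) * cnj (unitary_sym_coeff k g m l))" if "i < ?n" for i m
    using D(5)[OF that ij(2)] continuous_on_unitary_sym_coeff
    by (intro integrable_continuous continuous_intros) auto
  \<comment> \<open>Here j and l stay fixed, selecting the matrix unit, while i and m run over the
    entries of the average.\<close>
  define T where "T = Matrix.mat ?n (k + 1) (\<lambda>(i, m). ?I i m)"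
  have T: "T \<in> carrier_mat ?n (k + 1)" by (simp add: T_def)
  have "T * sym_rep k h = \<pi> h * T" if h: "h \<in> carrier SU2" for h
  proof (rule eq_matI)
    fix a b assume "a < dim_row (\<pi> h * T)" "b < dim_col (\<pi> h * T)"
    then have ab: "a < ?n" "b \<le> k" using D(2)[OF h] T by auto
    have "(\<pi> h * T) $$ (a, b) = (\<Sum>c<?n. \<pi> h $$ (a, c) * ?I c b)"
      using mult_mat_index[OF D(2)[OF h] T ab(1), of b] ab by (simp add: T_def)
    also have "\<dots> = (\<integral>g. (\<Sum>c<?n. \<pi> h $$ (a, c) * (\<pi> g $$ (c, j) * cnj (unitary_sym_coeff k g b l))) \<partial>\<mu>)"
      using int by (subst Bochner_Integration.integral_sum) auto
    \<comment> \<open>Writing g as h^-1 (h g) makes the integrand a function of h g, ready for left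
      invariance.\<close>
    also have "\<dots> = (\<integral>g. \<pi> (h ** g) $$ (a, j) * cnj (unitary_sym_coeff k (su2_inv h ** (h ** g)) b l) \<partial>\<mu>)"
    proof (intro Bochner_Integration.integral_cong refl)
      fix g assume "g \<in> space \<mu>"
      then have g: "g \<in> carrier SU2" by (simp add: space_haar)
      have "\<pi> (h ** g) $$ (a, j) = (\<Sum>c<?n. \<pi> h $$ (a, c) * \<pi> g $$ (c, j))"
        using D(4)[OF h g] mult_mat_index[OF D(2)[OF h] D(2)[OF g] ab(1) ij(2)] by simp
      moreover have "su2_inv h ** (h ** g) = g"
        by (simp add: matrix_mul_assoc su2_inv[OF h])
      ultimately show "(\<Sum>c<?n. \<pi> h $$ (a, c) * (\<pi> g $$ (c, j) * cnj (unitary_sym_coeff k g b l))) =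
          \<pi> (h ** g) $$ (a, j) * cnj (unitary_sym_coeff k (su2_inv h ** (h ** g)) b l)"
        by (simp add: sum_distrib_right mult.assoc)
    qed
    also have "\<dots> = (\<integral>g. \<pi> g $$ (a, j) * cnj (unitary_sym_coeff k (su2_inv h ** g) b l) \<partial>\<mu>)"
    proof (rule integral_left_mult[OF h, of "\<lambda>g. \<pi> g $$ (a, j) * cnj (unitary_sym_coeff k (su2_inv h ** g) b l)"])
      have "continuous_on (carrier SU2) (\<lambda>g. unitary_sym_coeff k (su2_inv h ** g) b l)"
        by (rule continuous_on_compose2[OF continuous_on_unitary_sym_coeff[of UNIV]
              continuous_on_matrix_mult_left]) auto
      then show "(\<lambda>g. \<pi> g $$ (a, j) * cnj (unitary_sym_coeff k (su2_inv h ** g) b l)) \<in> borel_measurable \<mu>"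
        using D(5)[OF ab(1) ij(2)] by (intro continuous_measurable continuous_intros) auto
    qed
    also have "\<dots> = (\<integral>g. (\<Sum>c\<le>k. unitary_sym_coeff k h c b *
        (\<pi> g $$ (a, j) * cnj (unitary_sym_coeff k g c l))) \<partial>\<mu>)"
    proof (intro Bochner_Integration.integral_cong refl)
      fix g
      have "cnj (unitary_sym_coeff k (su2_inv h ** g) b l) =
          (\<Sum>c\<le>k. cnj (unitary_sym_coeff k (su2_inv h) b c) * cnj (unitary_sym_coeff k g c l))"
        using ij(4) by (simp add: unitary_sym_coeff_mult)
      also have "\<dots> = (\<Sum>c\<le>k. unitary_sym_coeff k h c b * cnj (unitary_sym_coeff k g c l))"
        using ab(2) by (intro sum.cong) (auto simp: unitary_sym_coeff_inv)
      finally show "\<pi> g $$ (a, j) * cnj (unitary_sym_coeff k (su2_inv h ** g) b l) =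
          (\<Sum>c\<le>k. unitary_sym_coeff k h c b * (\<pi> g $$ (a, j) * cnj (unitary_sym_coeff k g c l)))"
        by (simp add: sum_distrib_left mult_ac)
    qed
    also have "\<dots> = (\<Sum>c\<le>k. unitary_sym_coeff k h c b * ?I a c)"
      using int[OF ab(1)] by (subst Bochner_Integration.integral_sum) auto
    also have "\<dots> = (T * sym_rep k h) $$ (a, b)"
      using mult_mat_index[OF T sym_rep_carrier[of k h] ab(1), of b] ab
      by (simp add: T_def mult.commute lessThan_Suc_atMost)
    finally show "(T * sym_rep k h) $$ (a, b) = (\<pi> h * T) $$ (a, b)" by simp
  qed (use D(2)[OF h] T in auto)
  with neq have "T = 0\<^sub>m ?n (k + 1)"
    using Schur_lemma[OF irreducible_sym_rep \<pi>, of T k] T by auto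
  then have "T $$ (i, m) = 0" using ij by simp
  then show ?thesis using ij by (simp add: T_def)
qed

text \<open>Products of characters are sums of characters, so a further factor \<open>cheb n\<close>
  preserves orthogonality to all characters. Used four times, this reaches the fourth power.\<close>

lemma orthogonal_cheb_mult:
  fixes \<psi> :: "complex^2^2 \<Rightarrow> complex" and f :: "real \<Rightarrow> real"
  assumes \<psi>: "continuous_on (carrier SU2) \<psi>" and f: "continuous_on UNIV f"
    and orth: "\<And>k. (\<integral>g. \<psi> g * of_real (f (su2_trace g) * cheb k (su2_trace g)) \<partial>\<mu>) = 0"
  shows "(\<integral>g. \<psi> g * of_real (f (su2_trace g) * cheb n (su2_trace g) * cheb k (su2_trace g)) \<partial>\<mu>) = 0"
proof -
  obtain h where h: "\<And>t. cheb n t * cheb k t = (\<Sum>l\<le>min n k. cheb (h l) t)"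
    using cheb_mult_as_sum by metis
  have "integrable \<mu> (\<lambda>g. \<psi> g * of_real (f (su2_trace g) * cheb l (su2_trace g)))" for l
    unfolding su2_trace_def
    by (intro integrable_continuous continuous_intros \<psi> continuous_on_compose2[OF f]) auto
  then have "(\<integral>g. (\<Sum>l\<le>min n k. \<psi> g * of_real (f (su2_trace g) * cheb (h l) (su2_trace g))) \<partial>\<mu>) = 0"
    using orth by (subst Bochner_Integration.integral_sum) (auto simp del: of_real_mult)
  then show ?thesis
    by (simp only: mult.assoc h) (simp add: sum_distrib_left)
qed

lemma SU2_irreducible_cases:
  assumes \<pi>: "irreducible_unitary_rep SU2 \<pi>"
  shows "\<exists>k. (sym_rep k, \<pi>) \<in> rep_equiv SU2"
proof (rule ccontr)
  assume "\<not> ?thesis"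
  then have neq: "(sym_rep k, \<pi>) \<notin> rep_equiv SU2" for k by blast
  note D = irreducible_unitary_repD[OF \<pi>]
  define \<psi> where "\<psi> = (\<lambda>g. \<pi> g $$ (0, 0))"
  have \<psi>: "continuous_on (carrier SU2) \<psi>" unfolding \<psi>_def by (rule D(5)[OF D(1) D(1)])
  have "(\<integral>g. \<psi> g * of_real (1 * cheb k (su2_trace g)) \<partial>\<mu>) = 0" for k
  proof -
    have "(\<integral>g. \<psi> g * of_real (1 * cheb k (su2_trace g)) \<partial>\<mu>) =
        (\<integral>g. (\<Sum>i\<le>k. \<psi> g * cnj (unitary_sym_coeff k g i i)) \<partial>\<mu>)"
    proof (intro Bochner_Integration.integral_cong refl)
      fix g assume "g \<in> space \<mu>"
      then have g: "g \<in> carrier SU2" by (simp add: space_haar)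
      have "complex_of_real (cheb k (su2_trace g)) = cnj (\<Sum>i\<le>k. unitary_sym_coeff k g i i)"
        using sym_trace_cheb[OF g, of k] by (simp add: unitary_sym_coeff_def binom_norm flip: cnj_sum)
      then show "\<psi> g * of_real (1 * cheb k (su2_trace g)) = (\<Sum>i\<le>k. \<psi> g * cnj (unitary_sym_coeff k g i i))"
        by (simp add: sum_distrib_left)
    qed
    also have "\<dots> = (\<Sum>i\<le>k. \<integral>g. \<psi> g * cnj (unitary_sym_coeff k g i i) \<partial>\<mu>)"
      by (intro Bochner_Integration.integral_sum integrable_continuous continuous_intros \<psi>
          continuous_on_unitary_sym_coeff)
    also have "\<dots> = 0"
      using matrix_coeff_orthogonal[OF \<pi> neq D(1) D(1)] by (simp add: \<psi>_def)
    finally show ?thesis .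
  qed
  note 0 = orthogonal_cheb_mult[OF \<psi> continuous_on_const this]
  have "(\<integral>g. \<psi> g * of_real (1 * cheb n (su2_trace g) * cheb n (su2_trace g) * cheb n (su2_trace g) *
      cheb n (su2_trace g) * cheb k (su2_trace g)) \<partial>\<mu>) = 0" for n k
    by (intro orthogonal_cheb_mult[OF \<psi>] 0 continuous_intros)
  then have orth: "(\<integral>g. \<psi> g * of_real (cheb n (su2_trace g) ^ 4 * cheb k (su2_trace g)) \<partial>\<mu>) = 0" for n k
    by (simp add: power4_eq_xxxx mult.assoc)
  have int: "integrable \<mu> (\<lambda>g. \<psi> g * of_real (f (su2_trace g)))" if "continuous_on UNIV f" for f
    unfolding su2_trace_def
    by (intro integrable_continuous continuous_intros \<psi> continuous_on_compose2[OF that]) auto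
  define w where "w = (\<lambda>n t. (2 + t) * cheb n t ^ 4)"
  have w0: "(\<integral>g. \<psi> g * of_real (w n (su2_trace g)) \<partial>\<mu>) = 0" for n
  proof -
    \<comment> \<open>The factor 2 + t of the weight is 2 \<open>cheb 0\<close> +
      \<open>cheb 1\<close>.\<close>
    have "(\<integral>g. \<psi> g * of_real (w n (su2_trace g)) \<partial>\<mu>) =
       (\<integral>g. 2 * (\<psi> g * of_real (cheb n (su2_trace g) ^ 4 * cheb 0 (su2_trace g))) +
          \<psi> g * of_real (cheb n (su2_trace g) ^ 4 * cheb (Suc 0) (su2_trace g)) \<partial>\<mu>)"
      by (intro Bochner_Integration.integral_cong refl) (simp add: w_def algebra_simps)
    also have "\<dots> = 0"
      by (subst Bochner_Integration.integral_add)
         (auto simp only: orth integral_mult_right_zero intro!: integrable_mult_right int continuous_intros, simp)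
    finally show ?thesis .
  qed
  obtain d where d: "d > 0" "\<And>g. g \<in> carrier SU2 \<Longrightarrow> dist g (Finite_Cartesian_Product.mat 1) < d \<Longrightarrow>
      dist (\<psi> g) (\<psi> (Finite_Cartesian_Product.mat 1)) < 1 / 2"
    using \<psi>[unfolded continuous_on_iff, rule_format, OF one_in_SU2, of "1 / 2"] by auto
  obtain e where e: "e > 0" "\<And>g. g \<in> carrier SU2 \<Longrightarrow> su2_trace g > 2 - e \<Longrightarrow>
      dist g (Finite_Cartesian_Product.mat 1) < d"
    using su2_trace_near_one[OF d(1)] by blast
  have \<psi>1: "\<psi> (Finite_Cartesian_Product.mat 1) = 1"
    unfolding \<psi>_def rep_one[OF \<pi>] using D(1) by simp
  have near: "Re (\<psi> g) \<ge> 1 / 2" if "g \<in> carrier SU2" "su2_trace g > 2 - e" for g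
  proof -
    have "cmod (\<psi> g - 1) < 1 / 2" using d(2)[OF that(1) e(2)[OF that]] by (simp add: \<psi>1 dist_norm)
    then show ?thesis using abs_Re_le_cmod[of "\<psi> g - 1"] by simp
  qed
  have far: "Re (\<psi> g) \<ge> - 1" if "g \<in> carrier SU2" for g
    using unitary_entry_le_1[OF D(2)[OF that] D(3)[OF that] D(1) D(1)] abs_Re_le_cmod[of "\<psi> g"]
    unfolding \<psi>_def by linarith
  \<comment> \<open>Near the identity Re \<psi> is at least 1/2; elsewhere it is at least -1 and the
    weight is at most 4 / e times the squared character. Hence weight / 2 minus 6 / e times that
    square bounds Re (\<psi> w) from below everywhere; the three integrals are n + 1, 6 / e and
    0.\<close>
  have "real (n + 1) \<le> 6 / e" for n
  proof -
    let ?r = "\<lambda>g. Re (\<psi> g * of_real (w n (su2_trace g)))"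
    let ?l = "\<lambda>g. w n (su2_trace g) / 2 - 6 / e * (cheb n (su2_trace g))\<^sup>2"
    have cw: "continuous_on UNIV (w n)" unfolding w_def by (intro continuous_intros)
    have "(\<integral>g. ?l g \<partial>\<mu>) \<le> (\<integral>g. ?r g \<partial>\<mu>)"
    proof (rule integral_mono)
      show "integrable \<mu> ?l" by (intro integrable_trace_fun continuous_intros cw) simp
      show "integrable \<mu> ?r" by (intro integrable_Re int cw)
      fix g assume "g \<in> space \<mu>"
      then have g: "g \<in> carrier SU2" by (simp add: space_haar)
      let ?t = "su2_trace g"
      have t2: "\<bar>?t\<bar> \<le> 2" by (rule abs_su2_trace_le[OF g])
      then have w_nonneg: "w n ?t \<ge> 0" by (simp add: w_def)
      have r: "?r g = Re (\<psi> g) * w n ?t" by simp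
      show "?l g \<le> ?r g"
      proof (cases "?t > 2 - e")
        case True
        have "1 / 2 * w n ?t \<le> Re (\<psi> g) * w n ?t"
          by (intro mult_right_mono near[OF g True] w_nonneg)
        moreover have "6 / e * (cheb n ?t)\<^sup>2 \<ge> 0" using e(1) by simp
        ultimately show ?thesis unfolding r by linarith
      next
        case False
        then have "w n ?t \<le> 4 / e * (cheb n ?t)\<^sup>2"
          unfolding w_def by (intro cheb_weight_le t2 e(1)) simp
        then have "3 / 2 * w n ?t \<le> 6 / e * (cheb n ?t)\<^sup>2" by simp
        moreover have "- 1 * w n ?t \<le> Re (\<psi> g) * w n ?t"
          by (intro mult_right_mono far[OF g] w_nonneg)
        ultimately show ?thesis unfolding r by linarith
      qed
    qed
    also have "(\<integral>g. ?r g \<partial>\<mu>) = Re (\<integral>g. \<psi> g * of_real (w n (su2_trace g)) \<partial>\<mu>)"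
      by (intro integral_Re int cw)
    also have "\<dots> = 0" by (simp add: w0)
    also have "(\<integral>g. ?l g \<partial>\<mu>) = (\<integral>g. w n (su2_trace g) / 2 \<partial>\<mu>) - (\<integral>g. 6 / e * (cheb n (su2_trace g))\<^sup>2 \<partial>\<mu>)"
      by (intro Bochner_Integration.integral_diff integrable_trace_fun continuous_intros cw) simp
    also have "(\<integral>g. w n (su2_trace g) / 2 \<partial>\<mu>) = real (n + 1)"
      using integral_cheb_weight[of n] by (simp add: w_def)
    also have "(\<integral>g. 6 / e * (cheb n (su2_trace g))\<^sup>2 \<partial>\<mu>) = 6 / e"
      using integral_cheb_mult[of n n] by (simp add: power2_eq_square)
    finally show ?thesis by simp
  qed
  moreover obtain n where "6 / e < real n" using reals_Archimedean2 by blast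
  ultimately show False by (metis add.commute le_add2 less_le_not_le of_nat_le_iff order_less_le_trans)
qed

end

subsection \<open>The zeta function of SU(2)\<close>

definition sym_class :: "nat \<Rightarrow> (complex^2^2 \<Rightarrow> complex mat) set" where
  "sym_class k = rep_equiv SU2 `` {sym_rep k}"

lemma sym_class_mem: "\<pi> \<in> sym_class k \<longleftrightarrow> (sym_rep k, \<pi>) \<in> rep_equiv SU2"
  by (simp add: sym_class_def)

lemma sym_rep_in_sym_class: "sym_rep k \<in> sym_class k"
  using equiv_class_self[OF equiv_rep_equiv, of "sym_rep k" SU2] irreducible_sym_rep
  by (simp add: sym_class_def)

lemma inj_sym_class: "inj sym_class"
proof (rule injI)
  fix k l assume "sym_class k = sym_class l"
  then have "sym_rep k \<in> sym_class l" using sym_rep_in_sym_class by blast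
  then show "k = l" using rep_equiv_degree[of "sym_rep l" "sym_rep k" SU2] by (simp add: sym_class_mem)
qed

lemma (in SU2_haar) unitary_dual_SU2: "unitary_dual SU2 = range sym_class"
proof (intro equalityI subsetI)
  fix c assume "c \<in> unitary_dual SU2"
  then obtain \<pi> where \<pi>: "irreducible_unitary_rep SU2 \<pi>" "c = rep_equiv SU2 `` {\<pi>}"
    by (auto simp: unitary_dual_def elim!: quotientE)
  obtain k where "(sym_rep k, \<pi>) \<in> rep_equiv SU2" using SU2_irreducible_cases[OF \<pi>(1)] by blast
  then have "c = sym_class k"
    unfolding \<pi>(2) sym_class_def using equiv_class_eq[OF equiv_rep_equiv] by metis
  then show "c \<in> range sym_class" by blast
next
  fix c assume "c \<in> range sym_class"
  then show "c \<in> unitary_dual SU2"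
    unfolding unitary_dual_def sym_class_def using irreducible_sym_rep by (auto intro!: quotientI)
qed

lemma mat_trace_sym_rep:
  assumes "g \<in> carrier SU2"
  shows "mat_trace (sym_rep k g) = of_real (cheb k (su2_trace g))"
  using sym_trace_cheb[OF assms, of k]
  by (simp add: mat_trace_def lessThan_Suc_atMost unitary_sym_coeff_def binom_norm)

text \<open>\<open>SOME\<close> may choose any representative; its trace and degree are those of
  \<open>sym_rep k\<close>.\<close>

lemma group_zeta_term_sym_class:
  assumes g: "g \<in> carrier SU2"
  shows "group_zeta_term SU2 s [g, g, g] (sym_class k) =
    of_real (cheb k (su2_trace g)) ^ 3 / of_nat (Suc k) powr (s + 3)"
proof -
  define \<rho> where "\<rho> = (SOME \<pi>. \<pi> \<in> sym_class k)"
  have "\<rho> \<in> sym_class k" unfolding \<rho>_def by (rule someI[of "\<lambda>\<pi>. \<pi> \<in> sym_class k"]) (rule sym_rep_in_sym_class)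
  then have equiv: "(sym_rep k, \<rho>) \<in> rep_equiv SU2" by (simp add: sym_class_mem)
  have "mat_trace (\<rho> g) = of_real (cheb k (su2_trace g))"
    using rep_equiv_trace[OF equiv g] mat_trace_sym_rep[OF g] by simp
  moreover have "rep_degree SU2 \<rho> = Suc k" using rep_equiv_degree[OF equiv] by simp
  ultimately show ?thesis
    by (simp add: group_zeta_term_def \<rho>_def[symmetric] power3_eq_cube mult.assoc)
qed

lemma summable_on_nat_iff:
  fixes f :: "nat \<Rightarrow> complex"
  shows "f summable_on UNIV \<longleftrightarrow> summable (\<lambda>n. norm (f n))"
  using summable_on_iff_abs_summable_on_complex[of f UNIV]
    summable_on_UNIV_nonneg_real_iff[of "\<lambda>n. norm (f n)"] by simp

text \<open>Summability is finiteness of the sum of norms in \<open>ennreal\<close>, a measurable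
  condition. The value 0 elsewhere matches the default of \<open>infsum\<close>.\<close>

lemma borel_measurable_suminf_if_summable:
  fixes f :: "nat \<Rightarrow> 'a \<Rightarrow> 'b::{banach, second_countable_topology}"
  assumes [measurable]: "\<And>n. f n \<in> borel_measurable M"
  shows "(\<lambda>x. if summable (\<lambda>n. norm (f n x)) then \<Sum>n. f n x else 0) \<in> borel_measurable M"
proof -
  have "summable (\<lambda>n. norm (f n x)) \<longleftrightarrow> (\<Sum>n. ennreal (norm (f n x))) \<noteq> \<infinity>" for x
    by (auto simp: ennreal_suminf_neq_top intro: summable_suminf_not_top)
  then show ?thesis by simp
qed

context SU2_haar
begin

lemma group_zeta_SU2:
  fixes s :: complex
  assumes g: "g \<in> carrier SU2"
  defines "f \<equiv> \<lambda>n. of_real (cheb n (su2_trace g)) ^ 3 / of_nat (Suc n) powr (s + 3)"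
  shows "group_zeta_term SU2 s [g, g, g] summable_on unitary_dual SU2 \<longleftrightarrow> summable (\<lambda>n. norm (f n))"
    and "group_zeta SU2 s [g, g, g] = (if summable (\<lambda>n. norm (f n)) then \<Sum>n. f n else 0)"
proof -
  have f: "group_zeta_term SU2 s [g, g, g] \<circ> sym_class = f"
    by (simp add: fun_eq_iff group_zeta_term_sym_class[OF g] f_def)
  show *: "group_zeta_term SU2 s [g, g, g] summable_on unitary_dual SU2 \<longleftrightarrow> summable (\<lambda>n. norm (f n))"
    unfolding unitary_dual_SU2 summable_on_reindex[OF inj_sym_class] f summable_on_nat_iff ..
  show "group_zeta SU2 s [g, g, g] = (if summable (\<lambda>n. norm (f n)) then \<Sum>n. f n else 0)"
  proof (cases "summable (\<lambda>n. norm (f n))")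
    case True
    have "group_zeta SU2 s [g, g, g] = infsum f UNIV"
      unfolding group_zeta_def unitary_dual_SU2 infsum_reindex[OF inj_sym_class] f ..
    also have "\<dots> = (\<Sum>n. f n)"
      using norm_summable_imp_has_sum[OF True summable_sums[OF summable_norm_cancel[OF True]]]
      by (rule infsumI)
    finally show ?thesis using True by simp
  next
    case False
    then show ?thesis using * by (simp add: group_zeta_def infsum_not_exists)
  qed
qed

lemma Z3_SU2_eq:
  assumes s: "Re s > - 2"
  shows "AE g in \<mu>. group_zeta_term SU2 s [g, g, g] summable_on unitary_dual SU2"
    and "integrable \<mu> (\<lambda>g. group_zeta SU2 s [g, g, g])"
    and "Z3_SU2 \<mu> s = (\<integral>g. (\<Sum>n. mat_trace (sym_power n g) ^ 3 / of_nat (Suc n) powr (s + 3)) \<partial>\<mu>)"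
    and "Z3_SU2 \<mu> s = (1 - 2 powr (- s - 3)) * dirichlet_zeta (s + 3)"
proof -
  define f where "f = (\<lambda>n g. complex_of_real (cheb n (su2_trace g)) ^ 3 / of_nat (Suc n) powr (s + 3))"
  have "Re (s + 3) > 1" using s by simp
  have f_apply: "complex_of_real (cheb n (su2_trace g)) ^ 3 / of_nat (Suc n) powr (s + 3) = f n g" for n g
    by (simp add: f_def)
  note series = cheb_series[OF \<open>Re (s + 3) > 1\<close>, unfolded f_apply]
  \<comment> \<open>The unordered sum over the dual equals the series wherever the latter converges
    absolutely, which is known almost everywhere.\<close>
  have AE_zeta: "AE g in \<mu>. group_zeta SU2 s [g, g, g] = (\<Sum>n. f n g)"
    using series(1) AE_space
    by eventually_elim (simp add: group_zeta_SU2(2) space_haar f_def)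
  show "AE g in \<mu>. group_zeta_term SU2 s [g, g, g] summable_on unitary_dual SU2"
    using series(1) AE_space
    by eventually_elim (simp add: group_zeta_SU2(1) space_haar f_def)
  have "f n \<in> borel_measurable \<mu>" for n
    unfolding f_def
    by (intro borel_measurable_divide continuous_measurable continuous_intros continuous_on_cheb_trace)
  then have "(\<lambda>g. if summable (\<lambda>n. norm (f n g)) then \<Sum>n. f n g else 0) \<in> borel_measurable \<mu>"
    by (rule borel_measurable_suminf_if_summable)
  then have meas: "(\<lambda>g. group_zeta SU2 s [g, g, g]) \<in> borel_measurable \<mu>"
    by (subst measurable_cong) (auto simp: space_haar group_zeta_SU2(2) f_def)
  show "integrable \<mu> (\<lambda>g. group_zeta SU2 s [g, g, g])"
    using series(2) AE_zeta meas
    by (subst integrable_cong_AE[of _ _ "\<lambda>g. \<Sum>n. f n g"]) auto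
  have Z: "Z3_SU2 \<mu> s = (\<integral>g. (\<Sum>n. f n g) \<partial>\<mu>)"
    unfolding Z3_SU2_def using series(2) AE_zeta meas by (intro integral_cong_AE) auto
  also have "\<dots> = (\<integral>g. (\<Sum>n. mat_trace (sym_power n g) ^ 3 / of_nat (Suc n) powr (s + 3)) \<partial>\<mu>)"
    by (intro Bochner_Integration.integral_cong refl) (simp add: f_def mat_trace_sym_power space_haar)
  finally show "Z3_SU2 \<mu> s = (\<integral>g. (\<Sum>n. mat_trace (sym_power n g) ^ 3 / of_nat (Suc n) powr (s + 3)) \<partial>\<mu>)" .
  show "Z3_SU2 \<mu> s = (1 - 2 powr (- s - 3)) * dirichlet_zeta (s + 3)"
    unfolding Z series(3) by simp
qed

end

theorem theorem3p4:
  fixes \<mu> :: "(complex^2^2) measure"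
  assumes "normalized_haar_measure SU2 \<mu>"
  shows "(\<forall>s. Re s > -2 \<longrightarrow>
           (AE g in \<mu>. group_zeta_term SU2 s [g, g, g] summable_on unitary_dual SU2) \<and>
           integrable \<mu> (\<lambda>g. group_zeta SU2 s [g, g, g]) \<and>
           Z3_SU2 \<mu> s =
             (\<integral>g. (\<Sum>n. mat_trace (sym_power n g) ^ 3 / of_nat (Suc n) powr (s + 3)) \<partial>\<mu>) \<and>
           Z3_SU2 \<mu> s = (1 - 2 powr (- s - 3)) * riemann_zeta (s + 3)) \<and>
         (\<exists>F. F meromorphic_on UNIV \<and> (\<forall>s. Re s > -2 \<longrightarrow> F s = Z3_SU2 \<mu> s))"
proof -
  interpret SU2_haar \<mu> using assms by unfold_locales
  obtain F where F: "F holomorphic_on UNIV" "\<And>s. s \<noteq> 1 \<Longrightarrow> riemann_zeta s = F s / (s - 1)"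
    "\<And>s. Re s > 1 \<Longrightarrow> riemann_zeta s = dirichlet_zeta s"
    using riemann_zeta_entire by blast
  have Z: "Z3_SU2 \<mu> s = (1 - 2 powr (- s - 3)) * riemann_zeta (s + 3)" if "Re s > - 2" for s
    using Z3_SU2_eq(4)[OF that] F(3)[of "s + 3"] that by simp
  \<comment> \<open>The quotient F (s + 3) / (s + 2) equals \<open>riemann_zeta (s + 3)\<close> off
    the pole and, having an entire numerator, is meromorphic on the whole plane.\<close>
  define G where "G = (\<lambda>s. (1 - 2 powr (- s - 3)) * (F (s + 3) / (s + 2)))"
  have "(\<lambda>s. F (s + 3)) holomorphic_on UNIV"
    by (intro holomorphic_on_compose_gen[OF _ F(1), unfolded o_def] holomorphic_intros) auto
  then have "(\<lambda>s. (1 - 2 powr (- s - 3)) * F (s + 3)) holomorphic_on UNIV"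
    by (intro holomorphic_intros) auto
  then have 1: "(\<lambda>s. (1 - 2 powr (- s - 3)) * F (s + 3)) meromorphic_on UNIV"
    by (intro analytic_on_imp_meromorphic_on) (simp add: analytic_on_open)
  have 2: "(\<lambda>s :: complex. s + 2) meromorphic_on UNIV"
    by (intro analytic_on_imp_meromorphic_on analytic_intros)
  have "G meromorphic_on UNIV"
    using meromorphic_on_divide[OF 1 2] by (simp add: G_def)
  moreover have "G s = Z3_SU2 \<mu> s" if "Re s > - 2" for s
  proof -
    have "s + 3 \<noteq> 1" using that by (auto simp: complex_eq_iff)
    then show ?thesis unfolding Z[OF that] G_def F(2)[OF \<open>s + 3 \<noteq> 1\<close>] by (simp add: algebra_simps)
  qed
  ultimately show ?thesis
    using Z3_SU2_eq Z by blast
qed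

end
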